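(* Let $X$ be a compact metrizable space, and let $\sigma:X\to X$ be a minimal free homeomorphism. Suppose $E,F\subseteq X$ are open sets satisfying $$\mu(E)<\tfrac14\mu(F),\qquad\mu\in\mathcal M_1(X,\sigma).$$ Then $\varphi_E\precsim\varphi_F$ in $\mathrm{C}(X)\rtimes_\sigma\mathbb Z$.
   Context: $\sigma$ is free if no nonzero power of $\sigma$ has a fixed point, and minimal if $\varnothing$ and $X$ are the only closed $\sigma$-invariant sets. $\mathcal M_1(X,\sigma)$ is the set of $\sigma$-invariant Borel probability measures on $X$. $\mathrm{C}(X)\rtimes_\sigma\mathbb Z$ is the crossed product C*-algebra of the $\mathbb Z$-action generated by $\sigma$. For an open $E\subseteq X$, $\varphi_E:X\to[0,\infty)$ is any continuous function with $E=\varphi_E^{-1}((0,\infty))$. $a\precsim b$ (Cuntz subequivalence) for positive $a,b$ in a C*-algebra $A$ means there are $x_n,y_n\in A$ with $x_nby_n\to a$. *)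

theory Defs
  imports "HOL-Probability.Probability_Measure" "HOL-Algebra.QuotRing" "HOL-Algebra.Module"
begin

section \<open>Enveloping C*-algebras and Cuntz subequivalence\<close>

record 'b star_algebra = "(complex, 'b) module" +
  adj :: "'b \<Rightarrow> 'b"
  nrm :: "'b \<Rightarrow> real"

definition cstar_seminorm :: "('b, 'm) star_algebra_scheme \<Rightarrow> ('b \<Rightarrow> real) \<Rightarrow> bool" where
  "cstar_seminorm B p \<longleftrightarrow>
     (\<forall>a\<in>carrier B. 0 \<le> p a) \<and>
     (\<forall>a\<in>carrier B. \<forall>b\<in>carrier B. p (a \<oplus>\<^bsub>B\<^esub> b) \<le> p a + p b) \<and>
     (\<forall>c. \<forall>a\<in>carrier B. p (c \<odot>\<^bsub>B\<^esub> a) = cmod c * p a) \<and>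
     (\<forall>a\<in>carrier B. \<forall>b\<in>carrier B. p (a \<otimes>\<^bsub>B\<^esub> b) \<le> p a * p b) \<and>
     (\<forall>a\<in>carrier B. p (adj B a \<otimes>\<^bsub>B\<^esub> a) = (p a)\<^sup>2)"

text \<open>The largest C*-seminorm dominated by the given norm of \<open>B\<close>.  The zero seminorm belongs
  to the family and \<open>nrm B a\<close> is an upper bound at \<open>a\<close>, so the supremum is a genuine one.\<close>

definition universal_norm :: "('b, 'm) star_algebra_scheme \<Rightarrow> 'b \<Rightarrow> real" where
  "universal_norm B a =
     (SUP p\<in>{p. cstar_seminorm B p \<and> (\<forall>b\<in>carrier B. p b \<le> nrm B b)}. p a)"

text \<open>Hausdorff completion with respect to the seminorm \<open>nrm B\<close>, as the quotient of the ring of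
  Cauchy sequences by the ideal of null sequences.\<close>

definition cauchy_ring :: "('b, 'm) star_algebra_scheme \<Rightarrow> (nat \<Rightarrow> 'b) ring" where
  "cauchy_ring B =
     \<lparr>carrier = {s. (\<forall>n. s n \<in> carrier B) \<and>
                    (\<forall>e>0. \<exists>N. \<forall>m\<ge>N. \<forall>n\<ge>N. nrm B (s m \<ominus>\<^bsub>B\<^esub> s n) < e)},
      monoid.mult = (\<lambda>s t n. s n \<otimes>\<^bsub>B\<^esub> t n),
      one = (\<lambda>n. \<one>\<^bsub>B\<^esub>),
      zero = (\<lambda>n. \<zero>\<^bsub>B\<^esub>),
      add = (\<lambda>s t n. s n \<oplus>\<^bsub>B\<^esub> t n)\<rparr>"

definition null_seqs :: "('b, 'm) star_algebra_scheme \<Rightarrow> (nat \<Rightarrow> 'b) set" where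
  "null_seqs B = {s \<in> carrier (cauchy_ring B). (\<lambda>n. nrm B (s n)) \<longlonglongrightarrow> 0}"

definition seq_class :: "('b, 'm) star_algebra_scheme \<Rightarrow> (nat \<Rightarrow> 'b) \<Rightarrow> (nat \<Rightarrow> 'b) set" where
  "seq_class B s = null_seqs B +>\<^bsub>cauchy_ring B\<^esub> s"

definition completion :: "('b, 'm) star_algebra_scheme \<Rightarrow> (nat \<Rightarrow> 'b) set star_algebra" where
  "completion B = (let Q = cauchy_ring B Quot null_seqs B in
     \<lparr>carrier = carrier Q, monoid.mult = monoid.mult Q, one = one Q, zero = zero Q, add = add Q,
      smult = (\<lambda>c P. \<Union>s\<in>P. seq_class B (\<lambda>n. c \<odot>\<^bsub>B\<^esub> s n)),
      adj = (\<lambda>P. \<Union>s\<in>P. seq_class B (\<lambda>n. adj B (s n))),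
      nrm = (\<lambda>P. THE r. \<exists>s\<in>P. (\<lambda>n. nrm B (s n)) \<longlonglongrightarrow> r)\<rparr>)"

definition enveloping_cstar_algebra ::
    "'b star_algebra \<Rightarrow> (nat \<Rightarrow> 'b) set star_algebra" where
  "enveloping_cstar_algebra B = completion (B\<lparr>nrm := universal_norm B\<rparr>)"

definition enveloping_embedding :: "'b star_algebra \<Rightarrow> 'b \<Rightarrow> (nat \<Rightarrow> 'b) set" where
  "enveloping_embedding B a = seq_class (B\<lparr>nrm := universal_norm B\<rparr>) (\<lambda>n. a)"

text \<open>Only meant for positive elements \<open>a\<close> and \<open>b\<close> of a C*-algebra \<open>A\<close>.\<close>

definition cuntz_subeq :: "('b, 'm) star_algebra_scheme \<Rightarrow> 'b \<Rightarrow> 'b \<Rightarrow> bool" where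
  "cuntz_subeq A a b \<longleftrightarrow>
     (\<exists>x y :: nat \<Rightarrow> 'b. (\<forall>n. x n \<in> carrier A) \<and> (\<forall>n. y n \<in> carrier A) \<and>
        (\<lambda>n. nrm A ((x n \<otimes>\<^bsub>A\<^esub> b \<otimes>\<^bsub>A\<^esub> y n) \<ominus>\<^bsub>A\<^esub> a)) \<longlonglongrightarrow> 0)"

section \<open>Homeomorphisms of a compact space\<close>

text \<open>The integer power of a bijection.  The inverse is not written \<open>inv\<close>, which HOL-Algebra
  overloads with the inverse in a group.\<close>

definition int_iterate :: "('a \<Rightarrow> 'a) \<Rightarrow> int \<Rightarrow> 'a \<Rightarrow> 'a" where
  "int_iterate \<sigma> n = (if 0 \<le> n then \<sigma> ^^ nat n else inv_into UNIV \<sigma> ^^ nat (- n))"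

definition free_homeo :: "('a \<Rightarrow> 'a) \<Rightarrow> bool" where
  "free_homeo \<sigma> \<longleftrightarrow> (\<forall>n. n \<noteq> 0 \<longrightarrow> (\<forall>x. int_iterate \<sigma> n x \<noteq> x))"

definition minimal_homeo :: "('a::topological_space \<Rightarrow> 'a) \<Rightarrow> bool" where
  "minimal_homeo \<sigma> \<longleftrightarrow> (\<forall>C. closed C \<and> \<sigma> ` C = C \<longrightarrow> C = {} \<or> C = UNIV)"

definition invariant_prob_measures :: "('a::topological_space \<Rightarrow> 'a) \<Rightarrow> 'a measure set" where
  "invariant_prob_measures \<sigma> =
     {\<mu>. prob_space \<mu> \<and> sets \<mu> = sets borel \<and> distr \<mu> borel \<sigma> = \<mu>}"

definition open_support_function :: "'a::topological_space set \<Rightarrow> ('a \<Rightarrow> real) \<Rightarrow> bool" where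
  "open_support_function E \<phi> \<longleftrightarrow>
     continuous_on UNIV \<phi> \<and> (\<forall>x. 0 \<le> \<phi> x) \<and> E = \<phi> -` {0<..}"

section \<open>The crossed product by a homeomorphism\<close>

text \<open>The *-algebra of finitely supported functions from the integers to the continuous complex
  functions on the space.  The function \<open>a\<close> stands for the finite sum \<open>\<Sum>n. a n * u^n\<close>, where \<open>u\<close>
  is a unitary with \<open>u * f * u^-1 = f \<circ> \<sigma>^-1\<close>; this dictates product and involution.
  The norm is that of \<open>l^1\<close> with values in the continuous functions with the supremum norm
  (the space is meant to be compact).\<close>

definition finsupp_crossed_product ::
    "('a::topological_space \<Rightarrow> 'a) \<Rightarrow> (int \<Rightarrow> 'a \<Rightarrow> complex) star_algebra" where
  "finsupp_crossed_product \<sigma> =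
     \<lparr>carrier = {a. finite {n. a n \<noteq> (\<lambda>x. 0)} \<and> (\<forall>n. continuous_on UNIV (a n))},
      monoid.mult =
        (\<lambda>a b n x. \<Sum>k | a k \<noteq> (\<lambda>x. 0). a k x * b (n - k) (int_iterate \<sigma> (- k) x)),
      one = (\<lambda>n x. if n = 0 then 1 else 0),
      zero = (\<lambda>n x. 0),
      add = (\<lambda>a b n x. a n x + b n x),
      smult = (\<lambda>c a n x. c * a n x),
      adj = (\<lambda>a n x. cnj (a (- n) (int_iterate \<sigma> (- n) x))),
      nrm = (\<lambda>a. \<Sum>n | a n \<noteq> (\<lambda>x. 0). SUP x. cmod (a n x))\<rparr>"

text \<open>The (full) crossed product is the enveloping C*-algebra of \<open>l^1\<close>; it is enough to
  complete the dense *-subalgebra of finitely supported functions.\<close>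

definition crossed_product ::
    "('a::topological_space \<Rightarrow> 'a) \<Rightarrow> (nat \<Rightarrow> int \<Rightarrow> 'a \<Rightarrow> complex) set star_algebra" where
  "crossed_product \<sigma> = enveloping_cstar_algebra (finsupp_crossed_product \<sigma>)"

definition crossed_embedding ::
    "('a::topological_space \<Rightarrow> 'a) \<Rightarrow> ('a \<Rightarrow> complex) \<Rightarrow> (nat \<Rightarrow> int \<Rightarrow> 'a \<Rightarrow> complex) set" where
  "crossed_embedding \<sigma> f =
     enveloping_embedding (finsupp_crossed_product \<sigma>) (\<lambda>n x. if n = 0 then f x else 0)"

end

theory Submission
  imports Defs "HOL-Analysis.Function_Topology"
begin

text \<open>If, for each n, some orbit segment of length n visited F at most twice as often as a compact
  subset of E, a cluster point of the empirical measures would give an invariant measure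
  contradicting the hypothesis.  Hence there are continuous \<open>e\<close> and \<open>f\<close>, supported in E and F and
  with values in [0, 1], such that \<open>e\<close> is 1 where \<open>\<phi>E\<close> is at least \<open>\<epsilon>\<close> and the Birkhoff sums of
  \<open>f - 2 * e\<close> of some fixed length are positive; averaging gives a continuous \<open>h\<close> with
  \<open>h + 2 * e \<le> f + h \<circ> \<sigma>\<close>.  Lay out each orbit on the real line, the point \<open>\<sigma>\<^sup>k x\<close> at the position
  \<open>P\<^sub>k x = f x + \<dots> + f (\<sigma>\<^sup>k\<^sup>-\<^sup>1 x)\<close>.  The open intervals from \<open>h x\<close> to \<open>h x + 2 * e x\<close> are then
  disjoint along the orbit, and where \<open>e x = 1\<close> the interval has length 2 and so contains a
  position of a point of F, as the steps are at most 1.  With \<open>w\<^sub>k x\<close> the distance of \<open>P\<^sub>k x\<close> to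
  the complement of this interval, the product of \<open>\<Sum>k. v\<^sub>k u\<^sup>-\<^sup>k\<close>, \<open>\<phi>F\<close> and \<open>\<Sum>l. u\<^sup>l w\<^sub>l\<close>, where \<open>v\<^sub>k\<close>
  is a multiple of \<open>w\<^sub>k\<close>, has no off-diagonal terms: \<open>\<sigma>\<^sup>k x = \<sigma>\<^sup>l y\<close>, \<open>w\<^sub>k x \<noteq> 0\<close> and
  \<open>w\<^sub>l y \<noteq> 0\<close> force \<open>k = l\<close>.  Its diagonal is within \<open>\<epsilon>\<close> of \<open>\<phi>E\<close> for a suitable multiple.  All this
  happens in the *-algebra of finite sums, and the universal norm is at most the l^1 norm.\<close>

section \<open>Completion of a seminormed ring\<close>

text \<open>Cuntz subequivalence is expressed through products, differences and the norm, so the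
  completion is studied for a ring with a submultiplicative seminorm.\<close>

locale seminormed_ring = ring B for B :: "('b, 'm) star_algebra_scheme" (structure) +
  assumes nrm_nonneg: "a \<in> carrier B \<Longrightarrow> 0 \<le> nrm B a"
    and nrm_zero: "nrm B \<zero> = 0"
    and nrm_uminus: "a \<in> carrier B \<Longrightarrow> nrm B (\<ominus> a) = nrm B a"
    and nrm_add: "a \<in> carrier B \<Longrightarrow> b \<in> carrier B \<Longrightarrow> nrm B (a \<oplus> b) \<le> nrm B a + nrm B b"
    and nrm_mult: "a \<in> carrier B \<Longrightarrow> b \<in> carrier B \<Longrightarrow> nrm B (a \<otimes> b) \<le> nrm B a * nrm B b"
begin

section \<open>Cauchy sequences and the ideal of null sequences\<close>

abbreviation CR where "CR \<equiv> cauchy_ring B"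

lemma nrm_minus: "a \<in> carrier B \<Longrightarrow> b \<in> carrier B \<Longrightarrow> nrm B (a \<ominus> b) \<le> nrm B a + nrm B b"
  using nrm_add[of a "\<ominus> b"] by (simp add: minus_eq nrm_uminus)

text \<open>Turns the epsilon condition into a limit along the product filter, so that sums and
  products of Cauchy sequences can be treated with the rules for limits.\<close>

lemma cauchy_ring_carrier_iff:
  "s \<in> carrier CR \<longleftrightarrow> (\<forall>n. s n \<in> carrier B) \<and>
     ((\<lambda>(m, n). nrm B (s m \<ominus> s n)) \<longlongrightarrow> 0) (sequentially \<times>\<^sub>F sequentially)"
proof -
  have "((\<lambda>(m, n). nrm B (s m \<ominus> s n)) \<longlongrightarrow> 0) (sequentially \<times>\<^sub>F sequentially) \<longleftrightarrow>
    (\<forall>e>0. \<exists>N. \<forall>m\<ge>N. \<forall>n\<ge>N. nrm B (s m \<ominus> s n) < e)" if "\<forall>n. s n \<in> carrier B"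
  proof -
    have "(\<forall>m\<ge>N. \<forall>n\<ge>N. nrm B (s n \<ominus> s m) < e) \<longleftrightarrow> (\<forall>m\<ge>N. \<forall>n\<ge>N. nrm B (s m \<ominus> s n) < e)" for N e
      by blast
    moreover have "\<bar>nrm B (s m \<ominus> s n)\<bar> = nrm B (s m \<ominus> s n)" for m n
      using that nrm_nonneg by simp
    ultimately show ?thesis
      by (simp only: tendsto_iff eventually_prod_sequentially dist_real_def case_prod_conv diff_0_right)
  qed
  then show ?thesis by (auto simp: cauchy_ring_def)
qed

lemma cauchy_ring_closed: "s \<in> carrier CR \<Longrightarrow> s n \<in> carrier B"
  by (simp add: cauchy_ring_carrier_iff)

lemma cauchy_ring_dominated:
  assumes "\<And>n. s n \<in> carrier B"
    and "\<And>m n. nrm B (s m \<ominus> s n) \<le> g (m, n)"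
    and "(g \<longlongrightarrow> 0) (sequentially \<times>\<^sub>F sequentially)"
  shows "s \<in> carrier CR"
  unfolding cauchy_ring_carrier_iff
proof (intro conjI allI assms(1))
  show "((\<lambda>(m, n). nrm B (s m \<ominus> s n)) \<longlongrightarrow> 0) (sequentially \<times>\<^sub>F sequentially)"
    by (rule tendsto_sandwich[OF _ _ tendsto_const assms(3)])
      (use assms nrm_nonneg in \<open>auto intro!: always_eventually\<close>)
qed

lemma cauchy_ring_bounded:
  assumes "s \<in> carrier CR"
  obtains C where "\<And>n. nrm B (s n) \<le> C" "0 \<le> C"
proof -
  have s: "s n \<in> carrier B" for n using assms by (rule cauchy_ring_closed)
  obtain N where N: "\<And>m n. m \<ge> N \<Longrightarrow> n \<ge> N \<Longrightarrow> nrm B (s m \<ominus> s n) < 1"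
    using assms by (auto simp: cauchy_ring_def) (metis zero_less_one)
  \<comment> \<open>The sum of the first norms replaces their maximum; the added 1 is the tolerance
    within which all later terms stay close to \<open>s N\<close>.\<close>
  define C where "C = (\<Sum>i\<le>N. nrm B (s i)) + 1"
  have *: "nrm B (s i) \<le> C - 1" if "i \<le> N" for i
    unfolding C_def using that s nrm_nonneg by (auto intro!: member_le_sum)
  have "nrm B (s n) \<le> C" for n
  proof (cases "n \<le> N")
    case False
    have "s n = (s n \<ominus> s N) \<oplus> s N" using s[of n] s[of N] by (simp add: minus_eq a_assoc l_neg)
    then have "nrm B (s n) \<le> nrm B (s n \<ominus> s N) + nrm B (s N)"
      using nrm_add[of "s n \<ominus> s N" "s N"] s by simp
    then show ?thesis using N[of n N] *[of N] False by simp
  qed (use * in fastforce)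
  moreover have "0 \<le> C" using calculation[of 0] nrm_nonneg[OF s, of 0] by linarith
  ultimately show ?thesis using that by blast
qed

lemma cauchy_ring_const: "a \<in> carrier B \<Longrightarrow> (\<lambda>n. a) \<in> carrier CR"
  by (rule cauchy_ring_dominated[where g = "\<lambda>_. 0"]) (auto simp: minus_eq r_neg nrm_zero)

lemma cauchy_ring_add:
  assumes "s \<in> carrier CR" "t \<in> carrier CR"
  shows "(\<lambda>n. s n \<oplus> t n) \<in> carrier CR"
proof (rule cauchy_ring_dominated)
  note c = assms[THEN cauchy_ring_closed]
  show "s n \<oplus> t n \<in> carrier B" for n using c by simp
  show "nrm B ((s m \<oplus> t m) \<ominus> (s n \<oplus> t n)) \<le>
      (\<lambda>q. (\<lambda>(m, n). nrm B (s m \<ominus> s n)) q + (\<lambda>(m, n). nrm B (t m \<ominus> t n)) q) (m, n)" for m n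
  proof -
    have "(s m \<oplus> t m) \<ominus> (s n \<oplus> t n) = (s m \<ominus> s n) \<oplus> (t m \<ominus> t n)"
      using c[of m] c[of n] by (simp add: minus_eq minus_add a_ac)
    then show ?thesis using nrm_add[of "s m \<ominus> s n" "t m \<ominus> t n"] c by simp
  qed
  show "((\<lambda>q. (\<lambda>(m, n). nrm B (s m \<ominus> s n)) q + (\<lambda>(m, n). nrm B (t m \<ominus> t n)) q) \<longlongrightarrow> 0)
      (sequentially \<times>\<^sub>F sequentially)"
    using tendsto_add[of _ 0 _ _ 0] assms unfolding cauchy_ring_carrier_iff by fastforce
qed

lemma cauchy_ring_uminus:
  assumes "s \<in> carrier CR"
  shows "(\<lambda>n. \<ominus> s n) \<in> carrier CR"
proof (rule cauchy_ring_dominated)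
  note c = assms[THEN cauchy_ring_closed]
  show "\<ominus> s n \<in> carrier B" for n using c by simp
  show "nrm B (\<ominus> s m \<ominus> \<ominus> s n) \<le> (\<lambda>(m, n). nrm B (s m \<ominus> s n)) (m, n)" for m n
  proof -
    have "\<ominus> s m \<ominus> \<ominus> s n = \<ominus> (s m \<ominus> s n)" using c by (simp add: minus_eq minus_add)
    then show ?thesis using nrm_uminus[of "s m \<ominus> s n"] c by simp
  qed
qed (use assms in \<open>simp add: cauchy_ring_carrier_iff\<close>)

lemma cauchy_ring_mult:
  assumes "s \<in> carrier CR" "t \<in> carrier CR"
  shows "(\<lambda>n. s n \<otimes> t n) \<in> carrier CR"
proof -
  note c = assms[THEN cauchy_ring_closed]
  obtain C where C: "\<And>n. nrm B (s n) \<le> C" "0 \<le> C" using cauchy_ring_bounded[OF assms(1)] by auto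
  obtain D where D: "\<And>n. nrm B (t n) \<le> D" "0 \<le> D" using cauchy_ring_bounded[OF assms(2)] by auto
  show ?thesis
  proof (rule cauchy_ring_dominated)
    show "s n \<otimes> t n \<in> carrier B" for n using c by simp
    show "nrm B ((s m \<otimes> t m) \<ominus> (s n \<otimes> t n)) \<le>
        (\<lambda>q. (\<lambda>(m, n). nrm B (s m \<ominus> s n)) q * D + C * (\<lambda>(m, n). nrm B (t m \<ominus> t n)) q) (m, n)" for m n
    proof -
      have "(s m \<otimes> t m) \<ominus> (s n \<otimes> t n) = (s m \<ominus> s n) \<otimes> t m \<oplus> s n \<otimes> (t m \<ominus> t n)"
        using c[of m] c[of n] by (simp add: minus_eq l_distr r_distr l_minus r_minus a_ac r_neg1 r_neg2)
      then have "nrm B ((s m \<otimes> t m) \<ominus> (s n \<otimes> t n))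
          \<le> nrm B ((s m \<ominus> s n) \<otimes> t m) + nrm B (s n \<otimes> (t m \<ominus> t n))"
        using nrm_add[of "(s m \<ominus> s n) \<otimes> t m" "s n \<otimes> (t m \<ominus> t n)"] c by simp
      also have "\<dots> \<le> nrm B (s m \<ominus> s n) * nrm B (t m) + nrm B (s n) * nrm B (t m \<ominus> t n)"
        by (intro add_mono nrm_mult) (use c in auto)
      also have "\<dots> \<le> nrm B (s m \<ominus> s n) * D + C * nrm B (t m \<ominus> t n)"
        by (intro add_mono mult_left_mono mult_right_mono C D nrm_nonneg) (use c in auto)
      finally show ?thesis by simp
    qed
    show "((\<lambda>q. (\<lambda>(m, n). nrm B (s m \<ominus> s n)) q * D + C * (\<lambda>(m, n). nrm B (t m \<ominus> t n)) q) \<longlongrightarrow> 0)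
        (sequentially \<times>\<^sub>F sequentially)"
      using assms unfolding cauchy_ring_carrier_iff
      by (intro tendsto_add_zero tendsto_mult_left_zero tendsto_mult_right_zero) auto
  qed
qed

lemma cauchy_ring_simps:
  "s \<oplus>\<^bsub>CR\<^esub> t = (\<lambda>n. s n \<oplus> t n)" "s \<otimes>\<^bsub>CR\<^esub> t = (\<lambda>n. s n \<otimes> t n)"
  "\<zero>\<^bsub>CR\<^esub> = (\<lambda>n. \<zero>)" "\<one>\<^bsub>CR\<^esub> = (\<lambda>n. \<one>)"
  by (auto simp: cauchy_ring_def)

lemma ring_cauchy_ring: "ring CR"
proof (intro ringI abelian_groupI monoidI)
  fix s assume s: "s \<in> carrier CR"
  show "\<exists>t\<in>carrier CR. t \<oplus>\<^bsub>CR\<^esub> s = \<zero>\<^bsub>CR\<^esub>"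
    using cauchy_ring_uminus[OF s] cauchy_ring_closed[OF s]
    by (intro bexI[of _ "\<lambda>n. \<ominus> s n"]) (auto simp: cauchy_ring_simps l_neg)
next
  fix s t u assume "s \<in> carrier CR" "t \<in> carrier CR" "u \<in> carrier CR"
  note c = this[THEN cauchy_ring_closed]
  show "s \<oplus>\<^bsub>CR\<^esub> t \<oplus>\<^bsub>CR\<^esub> u = s \<oplus>\<^bsub>CR\<^esub> (t \<oplus>\<^bsub>CR\<^esub> u)"
    "s \<otimes>\<^bsub>CR\<^esub> t \<otimes>\<^bsub>CR\<^esub> u = s \<otimes>\<^bsub>CR\<^esub> (t \<otimes>\<^bsub>CR\<^esub> u)"
    "(s \<oplus>\<^bsub>CR\<^esub> t) \<otimes>\<^bsub>CR\<^esub> u = s \<otimes>\<^bsub>CR\<^esub> u \<oplus>\<^bsub>CR\<^esub> t \<otimes>\<^bsub>CR\<^esub> u"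
    "u \<otimes>\<^bsub>CR\<^esub> (s \<oplus>\<^bsub>CR\<^esub> t) = u \<otimes>\<^bsub>CR\<^esub> s \<oplus>\<^bsub>CR\<^esub> u \<otimes>\<^bsub>CR\<^esub> t"
    using c by (simp_all add: cauchy_ring_simps a_assoc m_assoc l_distr r_distr)
next
  fix s t assume "s \<in> carrier CR" "t \<in> carrier CR"
  then show "s \<oplus>\<^bsub>CR\<^esub> t = t \<oplus>\<^bsub>CR\<^esub> s"
    by (simp add: cauchy_ring_simps cauchy_ring_closed a_comm fun_eq_iff)
qed (simp_all add: cauchy_ring_simps cauchy_ring_closed cauchy_ring_add cauchy_ring_mult cauchy_ring_const)

lemma cauchy_ring_a_inv:
  assumes "s \<in> carrier CR"
  shows "\<ominus>\<^bsub>CR\<^esub> s = (\<lambda>n. \<ominus> s n)"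
proof -
  interpret C: ring CR by (rule ring_cauchy_ring)
  show ?thesis
    by (rule C.minus_equality)
      (use assms in \<open>auto simp: cauchy_ring_simps cauchy_ring_closed l_neg intro: cauchy_ring_uminus\<close>)
qed

lemma null_seqs_iff: "s \<in> null_seqs B \<longleftrightarrow> s \<in> carrier CR \<and> (\<lambda>n. nrm B (s n)) \<longlonglongrightarrow> 0"
  by (simp add: null_seqs_def)

lemma null_seqs_dominated:
  assumes "s \<in> carrier CR" "\<And>n. nrm B (s n) \<le> g n" "g \<longlonglongrightarrow> 0"
  shows "s \<in> null_seqs B"
proof -
  have "(\<lambda>n. nrm B (s n)) \<longlonglongrightarrow> 0"
    by (rule tendsto_sandwich[OF _ _ tendsto_const assms(3)])
      (use assms nrm_nonneg cauchy_ring_closed in \<open>auto intro!: always_eventually\<close>)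
  with assms(1) show ?thesis by (simp add: null_seqs_iff)
qed

lemma ideal_null_seqs: "ideal (null_seqs B) CR"
proof (rule idealI[OF ring_cauchy_ring])
  interpret C: ring CR by (rule ring_cauchy_ring)
  show "subgroup (null_seqs B) (add_monoid CR)"
  proof (rule group.subgroupI[OF C.add.is_group])
    show "null_seqs B \<subseteq> carrier (add_monoid CR)" by (auto simp: null_seqs_def)
    have "\<zero>\<^bsub>CR\<^esub> \<in> null_seqs B"
      by (auto simp: null_seqs_iff cauchy_ring_simps nrm_zero intro!: cauchy_ring_const)
    then show "null_seqs B \<noteq> {}" by blast
  next
    fix s assume s: "s \<in> null_seqs B"
    then have "nrm B (\<ominus> s n) = nrm B (s n)" for n
      by (auto simp: null_seqs_iff cauchy_ring_closed nrm_uminus)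
    moreover have "inv\<^bsub>add_monoid CR\<^esub> s = (\<lambda>n. \<ominus> s n)"
      using s cauchy_ring_a_inv[of s] unfolding null_seqs_iff a_inv_def[of CR] by blast
    ultimately show "inv\<^bsub>add_monoid CR\<^esub> s \<in> null_seqs B"
      using s cauchy_ring_uminus[of s] by (simp add: null_seqs_iff)
  next
    fix s t assume st: "s \<in> null_seqs B" "t \<in> null_seqs B"
    then have c: "s \<in> carrier CR" "t \<in> carrier CR" by (auto simp: null_seqs_iff)
    have "(\<lambda>n. s n \<oplus> t n) \<in> null_seqs B"
    proof (rule null_seqs_dominated[OF cauchy_ring_add[OF c]])
      show "nrm B (s n \<oplus> t n) \<le> nrm B (s n) + nrm B (t n)" for n
        by (intro nrm_add cauchy_ring_closed c)
      show "(\<lambda>n. nrm B (s n) + nrm B (t n)) \<longlonglongrightarrow> 0"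
        using st by (intro tendsto_add_zero) (auto simp: null_seqs_iff)
    qed
    then show "s \<otimes>\<^bsub>add_monoid CR\<^esub> t \<in> null_seqs B"
      by (simp add: cauchy_ring_simps)
  qed
next
  fix s t assume s: "s \<in> null_seqs B" and t: "t \<in> carrier CR"
  obtain D where D: "\<And>n. nrm B (t n) \<le> D" "0 \<le> D" using cauchy_ring_bounded[OF t] by auto
  note c = cauchy_ring_closed[OF t] cauchy_ring_closed[of s]
  have s': "s \<in> carrier CR" "(\<lambda>n. nrm B (s n)) \<longlonglongrightarrow> 0" using s by (auto simp: null_seqs_iff)
  have "nrm B (t n \<otimes> s n) \<le> D * nrm B (s n)" "nrm B (s n \<otimes> t n) \<le> nrm B (s n) * D" for n
    using nrm_mult[of "t n" "s n"] nrm_mult[of "s n" "t n"] D nrm_nonneg[of "s n"] c s'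
    by (meson mult_left_mono mult_right_mono order_trans)+
  note le = this
  show "t \<otimes>\<^bsub>CR\<^esub> s \<in> null_seqs B" "s \<otimes>\<^bsub>CR\<^esub> t \<in> null_seqs B"
    unfolding cauchy_ring_simps using s' t
    by (auto intro: null_seqs_dominated[OF _ le(1)] null_seqs_dominated[OF _ le(2)] cauchy_ring_mult
        tendsto_mult_left_zero tendsto_mult_right_zero)
qed

section \<open>Constant sequences in the completion\<close>

text \<open>The coset map onto the quotient by the ideal of null sequences is a ring homomorphism,
  and \<open>completion\<close> copies the ring operations of that quotient. This allows computing
  in the dense subring of constant sequences.\<close>

lemma seq_class_const_hom:
  assumes "a \<in> carrier B" "b \<in> carrier B"
  shows "seq_class B (\<lambda>_. a) \<otimes>\<^bsub>completion B\<^esub> seq_class B (\<lambda>_. b) = seq_class B (\<lambda>_. a \<otimes> b)"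
    and "seq_class B (\<lambda>_. a) \<ominus>\<^bsub>completion B\<^esub> seq_class B (\<lambda>_. b) = seq_class B (\<lambda>_. a \<ominus> b)"
    and "seq_class B (\<lambda>_. a) \<in> carrier (completion B)"
proof -
  interpret I: ideal "null_seqs B" CR by (rule ideal_null_seqs)
  interpret h: ring_hom_ring CR "CR Quot null_seqs B" "(+>\<^bsub>CR\<^esub>) (null_seqs B)"
    by (rule I.rcos_ring_hom_ring)
  note c = assms[THEN cauchy_ring_const]
  show "seq_class B (\<lambda>_. a) \<otimes>\<^bsub>completion B\<^esub> seq_class B (\<lambda>_. b) = seq_class B (\<lambda>_. a \<otimes> b)"
    using h.hom_mult[OF c] by (simp add: seq_class_def completion_def Let_def cauchy_ring_simps)
  \<comment> \<open>The additive inverse is defined from carrier, addition and zero alone, and these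
    agree in the two records.\<close>
  have "seq_class B (\<lambda>_. a) \<ominus>\<^bsub>completion B\<^esub> seq_class B (\<lambda>_. b)
      = seq_class B (\<lambda>_. a) \<ominus>\<^bsub>CR Quot null_seqs B\<^esub> seq_class B (\<lambda>_. b)"
    unfolding a_minus_def a_inv_def m_inv_def by (simp add: completion_def Let_def)
  also have "\<dots> = seq_class B (\<lambda>_. a \<ominus> b)"
    using h.hom_add[OF c(1) I.a_inv_closed[OF c(2)]] h.hom_a_inv[OF c(2)]
    unfolding seq_class_def a_minus_def cauchy_ring_a_inv[OF c(2)] cauchy_ring_simps by simp
  finally show "seq_class B (\<lambda>_. a) \<ominus>\<^bsub>completion B\<^esub> seq_class B (\<lambda>_. b) = seq_class B (\<lambda>_. a \<ominus> b)" .
  show "seq_class B (\<lambda>_. a) \<in> carrier (completion B)"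
    using h.hom_closed[OF c(1)] by (simp add: seq_class_def completion_def Let_def)
qed

text \<open>The triangle inequality in both directions. The sequences \<open>z n \<oplus> a\<close>
  are exactly the representatives of the class of the constant \<open>a\<close>.\<close>

lemma nrm_add_null_seq:
  assumes z: "z \<in> null_seqs B" and a: "a \<in> carrier B"
  shows "(\<lambda>n. nrm B (z n \<oplus> a)) \<longlonglongrightarrow> nrm B a"
proof -
  have zc: "z n \<in> carrier B" for n
    using z cauchy_ring_closed unfolding null_seqs_iff by blast
  have "norm (nrm B (z n \<oplus> a) - nrm B a) \<le> nrm B (z n)" for n
  proof -
    have "(z n \<oplus> a) \<ominus> z n = a"
      using zc[of n] a by (simp add: minus_eq a_comm[of "z n" a] a_assoc r_neg)
    then have "nrm B a \<le> nrm B (z n \<oplus> a) + nrm B (z n)"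
      using nrm_minus[of "z n \<oplus> a" "z n"] zc[of n] a by simp
    then show ?thesis using nrm_add[OF zc[of n] a] by simp
  qed
  moreover have "(\<lambda>n. nrm B (z n)) \<longlonglongrightarrow> 0" using z by (simp add: null_seqs_iff)
  ultimately have "(\<lambda>n. nrm B (z n \<oplus> a) - nrm B a) \<longlonglongrightarrow> 0"
    by (rule Lim_null_comparison[OF always_eventually[OF allI]])
  then show ?thesis by (simp add: LIM_zero_iff)
qed

text \<open>The norm of a class is a definite description. It is pinned down because the norms along
  every representative tend to \<open>nrm B a\<close>.\<close>

lemma nrm_seq_class_const:
  assumes a: "a \<in> carrier B"
  shows "nrm (completion B) (seq_class B (\<lambda>_. a)) = nrm B a"
proof -
  have elem: "s \<in> seq_class B (\<lambda>_. a) \<longleftrightarrow> (\<exists>z\<in>null_seqs B. s = (\<lambda>n. z n \<oplus> a))" for s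
    unfolding seq_class_def a_r_coset_def' cauchy_ring_simps by blast
  have lim: "(\<lambda>n. nrm B (s n)) \<longlonglongrightarrow> nrm B a" if "s \<in> seq_class B (\<lambda>_. a)" for s
    using that nrm_add_null_seq[OF _ a] unfolding elem by blast
  have mem: "(\<lambda>n. \<zero> \<oplus> a) \<in> seq_class B (\<lambda>_. a)"
    unfolding elem null_seqs_iff
    by (rule bexI[of _ "\<lambda>_. \<zero>"]) (simp_all add: null_seqs_iff cauchy_ring_const nrm_zero)
  have "(THE r. \<exists>s\<in>seq_class B (\<lambda>_. a). (\<lambda>n. nrm B (s n)) \<longlonglongrightarrow> r) = nrm B a"
  proof (rule the_equality)
    show "\<exists>s\<in>seq_class B (\<lambda>_. a). (\<lambda>n. nrm B (s n)) \<longlonglongrightarrow> nrm B a"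
      using lim[OF mem] mem by (rule bexI[where x = "\<lambda>n. \<zero> \<oplus> a"])
    fix r assume "\<exists>s\<in>seq_class B (\<lambda>_. a). (\<lambda>n. nrm B (s n)) \<longlonglongrightarrow> r"
    then obtain s where s: "s \<in> seq_class B (\<lambda>_. a)" "(\<lambda>n. nrm B (s n)) \<longlonglongrightarrow> r" ..
    show "r = nrm B a" by (rule LIMSEQ_unique[OF s(2) lim[OF s(1)]])
  qed
  then show ?thesis unfolding completion_def Let_def by simp
qed

end

section \<open>Invariant measures from invariant contents\<close>

text \<open>Finite additivity on all subsets is what survives in a cluster point of empirical
  measures; countable additivity has to be recovered from compactness by the construction of
  \<open>extension\<close>.\<close>

locale invariant_content =
  fixes \<sigma> :: "'a::metric_space \<Rightarrow> 'a" and m :: "'a set \<Rightarrow> real"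
  assumes compact_UNIV: "compact (UNIV :: 'a set)"
    and homeo: "homeomorphic_map euclidean euclidean \<sigma>"
    and nonneg: "0 \<le> m A"
    and total: "m UNIV = 1"
    and additive: "A \<inter> B = {} \<Longrightarrow> m (A \<union> B) = m A + m B"
    and invariant: "m (\<sigma> -` A) = m A"
begin

lemma mono: "A \<subseteq> B \<Longrightarrow> m A \<le> m B"
  using additive[of A "B - A"] nonneg[of "B - A"] by (simp add: Un_absorb1)

lemma empty: "m {} = 0"
  using additive[of "{}" "{}"] by simp

lemma subadditive: "m (A \<union> B) \<le> m A + m B"
  using additive[of A "B - A"] mono[of "B - A" B] by simp

lemma finite_subadditive: "finite I \<Longrightarrow> m (\<Union>i\<in>I. A i) \<le> (\<Sum>i\<in>I. m (A i))"
proof (induction I rule: finite_induct)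
  case (insert i I)
  then show ?case using subadditive[of "A i" "\<Union>i\<in>I. A i"] by simp
qed (simp add: empty)

text \<open>The Borel measure induced by the content: inner approximation of open sets by closed ones,
  then outer approximation of arbitrary sets by open ones.\<close>

definition inner :: "'a set \<Rightarrow> ennreal" where
  "inner U = (SUP L\<in>{L. closed L \<and> L \<subseteq> U}. ennreal (m L))"

definition outer :: "'a set \<Rightarrow> ennreal" where
  "outer A = (INF U\<in>{U. open U \<and> A \<subseteq> U}. inner U)"

lemma le_inner: "closed L \<Longrightarrow> L \<subseteq> U \<Longrightarrow> ennreal (m L) \<le> inner U"
  unfolding inner_def by (intro SUP_upper) auto

lemma inner_leI: "(\<And>L. closed L \<Longrightarrow> L \<subseteq> U \<Longrightarrow> ennreal (m L) \<le> r) \<Longrightarrow> inner U \<le> r"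
  unfolding inner_def by (intro SUP_least) auto

lemma inner_mono: "U \<subseteq> V \<Longrightarrow> inner U \<le> inner V"
  by (intro inner_leI le_inner) auto

lemma outer_le_inner: "open U \<Longrightarrow> A \<subseteq> U \<Longrightarrow> outer A \<le> inner U"
  unfolding outer_def by (intro INF_lower) auto

lemma outer_geI: "(\<And>U. open U \<Longrightarrow> A \<subseteq> U \<Longrightarrow> r \<le> inner U) \<Longrightarrow> r \<le> outer A"
  unfolding outer_def by (intro INF_greatest) auto

lemma outer_open: "open U \<Longrightarrow> outer U = inner U"
  by (intro antisym outer_le_inner outer_geI inner_mono) auto

lemma outer_mono: "A \<subseteq> B \<Longrightarrow> outer A \<le> outer B"
  by (intro outer_geI outer_le_inner) auto

lemma outer_empty: "outer {} = 0"
  by (auto simp: outer_open inner_def empty)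

lemma outer_UNIV: "outer UNIV = 1"
proof -
  have "inner UNIV \<le> 1"
    by (intro inner_leI) (use mono total in \<open>metis ennreal_1 ennreal_leI subset_UNIV\<close>)
  moreover have "1 \<le> inner UNIV"
    using le_inner[of UNIV UNIV] total by simp
  ultimately show ?thesis by (simp add: outer_open)
qed

text \<open>By compactness a closed subset of the union meets only finitely many \<open>U i\<close>
  in an essential way, and a Lebesgue number of this finite cover cuts it into closed pieces, each
  inside one \<open>U i\<close>. Finite subadditivity of \<open>m\<close> applies to the
  pieces.\<close>

lemma inner_countably_subadditive:
  assumes U: "\<And>i::nat. open (U i)"
  shows "inner (\<Union>i. U i) \<le> (\<Sum>i. inner (U i))"
proof (rule inner_leI)
  fix L assume L: "closed L" "L \<subseteq> (\<Union>i. U i)"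
  then have "compact L" using compact_UNIV by (metis Int_UNIV_left compact_Int_closed)
  obtain I where I: "finite I" "L \<subseteq> (\<Union>i\<in>I. U i)"
    using compactE_image[OF \<open>compact L\<close>, of UNIV U] U L by auto
  then obtain \<delta> where \<delta>: "\<delta> > 0" "\<And>x. x \<in> L \<Longrightarrow> \<exists>G\<in>U ` I. ball x \<delta> \<subseteq> G"
    using Heine_Borel_lemma[OF \<open>compact L\<close>, of "U ` I"] U by (metis (no_types, lifting) image_iff)
  \<comment> \<open>The points of \<open>L\<close> at distance at least \<open>\<delta>\<close> from
    the complement of \<open>U i\<close>: a closed condition, met by every point whose
    \<open>\<delta>\<close>-ball lies in \<open>U i\<close>.\<close>
  define K where "K i = L \<inter> (\<Inter>y\<in>-U i. {x. \<delta> \<le> dist x y})" for i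
  have K: "closed (K i)" for i unfolding K_def
    by (intro closed_Int L closed_INT ballI closed_Collect_le continuous_intros)
  have KU: "K i \<subseteq> U i" for i unfolding K_def using \<delta>(1) by force
  have "L \<subseteq> (\<Union>i\<in>I. K i)"
  proof
    fix x assume x: "x \<in> L"
    then obtain i where "i \<in> I" "ball x \<delta> \<subseteq> U i" using \<delta>(2) by blast
    then show "x \<in> (\<Union>i\<in>I. K i)" unfolding K_def using x by (force simp: subset_eq)
  qed
  then have "m L \<le> (\<Sum>i\<in>I. m (K i))"
    using mono finite_subadditive[OF I(1)] order_trans by blast
  then have "ennreal (m L) \<le> ennreal (\<Sum>i\<in>I. m (K i))" by (rule ennreal_leI)
  also have "\<dots> = (\<Sum>i\<in>I. ennreal (m (K i)))" using nonneg by (simp add: sum_ennreal)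
  also have "\<dots> \<le> (\<Sum>i\<in>I. inner (U i))" by (intro sum_mono le_inner K KU)
  also have "\<dots> \<le> (\<Sum>i. inner (U i))" using I(1) by (intro sum_le_suminf) auto
  finally show "ennreal (m L) \<le> (\<Sum>i. inner (U i))" .
qed

lemma outer_countably_subadditive: "outer (\<Union>i::nat. A i) \<le> (\<Sum>i. outer (A i))"
proof (rule ennreal_le_epsilon)
  fix e :: real assume e: "0 < e" and fin: "(\<Sum>n. outer (A n)) < top_class.top"
  have "\<exists>U. open U \<and> A n \<subseteq> U \<and> inner U \<le> outer (A n) + e * (1/2) ^ Suc n" for n
  proof -
    \<comment> \<open>Strict because the finiteness of the whole sum makes
      \<open>outer (A n)\<close> finite.\<close>
    have "outer (A n) < outer (A n) + e * (1/2) ^ Suc n"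
      using fin e by (auto simp: less_top dest!: ennreal_suminf_lessD)
    then show ?thesis unfolding outer_def[of "A n"] INF_less_iff by (auto intro: less_imp_le)
  qed
  then obtain U where U: "\<And>n. open (U n)" "\<And>n. A n \<subseteq> U n"
      "\<And>n. inner (U n) \<le> outer (A n) + e * (1/2) ^ Suc n"
    by metis
  have "outer (\<Union>i. A i) \<le> inner (\<Union>i. U i)" using U by (intro outer_le_inner) auto
  also have "\<dots> \<le> (\<Sum>n. inner (U n))" by (rule inner_countably_subadditive[OF U(1)])
  also have "\<dots> \<le> (\<Sum>n. outer (A n) + ennreal (e * (1/2) ^ Suc n))" by (intro suminf_le U) auto
  also have "\<dots> = (\<Sum>n. outer (A n)) + (\<Sum>n. ennreal (e * (1/2) ^ Suc n))"
    by (intro suminf_add[symmetric]) auto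
  also have "(\<Sum>n. ennreal (e * (1/2) ^ Suc n)) = ennreal e"
    using e sums_mult[OF power_half_series, of e] by (intro suminf_ennreal_eq) auto
  finally show "outer (\<Union>i. A i) \<le> (\<Sum>n. outer (A n)) + e" .
qed

lemma outer_subadditive: "outer (A \<union> B) \<le> outer A + outer B"
proof -
  have "outer (\<Union>i::nat. binaryset A B i) \<le> (\<Sum>i. outer (binaryset A B i))"
    by (rule outer_countably_subadditive)
  also have "\<dots> = outer A + outer B"
    by (rule sums_unique[symmetric, OF binaryset_sums]) (rule outer_empty)
  finally show ?thesis by (simp add: UN_binaryset_eq)
qed

text \<open>The Caratheodory condition for open sets. For open \<open>V\<close> around
  \<open>A\<close>, take a closed \<open>L\<close> inside \<open>U \<inter> V\<close> and then a
  closed \<open>K\<close> inside \<open>V - L\<close>, which contains \<open>A - U\<close>. The two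
  are disjoint, so their contents add up to at most \<open>inner V\<close>; now take suprema over
  \<open>K\<close>, then over \<open>L\<close>.\<close>

lemma outer_split:
  assumes U: "open U"
  shows "outer (U \<inter> A) + outer (A - U) \<le> outer A"
proof (rule outer_geI)
  fix V assume V: "open V" "A \<subseteq> V"
  have *: "ennreal (m L) + outer (A - U) \<le> inner V" if L: "closed L" "L \<subseteq> U \<inter> V" for L
  proof -
    have "outer (A - U) \<le> inner (V - L)" using V L by (intro outer_le_inner) auto
    then have "ennreal (m L) + outer (A - U) \<le> inner (V - L) + ennreal (m L)"
      by (simp add: add.commute add_left_mono)
    also have "\<dots> = (SUP K\<in>{K. closed K \<and> K \<subseteq> V - L}. ennreal (m K) + ennreal (m L))"
      unfolding inner_def by (rule ennreal_SUP_add_left[symmetric]) auto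
    also have "\<dots> \<le> inner V"
    proof (rule SUP_least)
      fix K assume "K \<in> {K. closed K \<and> K \<subseteq> V - L}"
      then have K: "closed K" "K \<subseteq> V - L" by auto
      then have "K \<inter> L = {}" by auto
      then have "ennreal (m K) + ennreal (m L) = ennreal (m (K \<union> L))"
        using nonneg additive by simp
      also have "\<dots> \<le> inner V" using K L by (intro le_inner) auto
      finally show "ennreal (m K) + ennreal (m L) \<le> inner V" .
    qed
    finally show ?thesis .
  qed
  have "outer (U \<inter> A) \<le> inner (U \<inter> V)" using U V by (intro outer_le_inner) auto
  then have "outer (U \<inter> A) + outer (A - U) \<le> inner (U \<inter> V) + outer (A - U)"
    by (rule add_right_mono)
  also have "\<dots> = (SUP L\<in>{L. closed L \<and> L \<subseteq> U \<inter> V}. ennreal (m L) + outer (A - U))"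
    unfolding inner_def by (rule ennreal_SUP_add_left[symmetric]) auto
  also have "\<dots> \<le> inner V" by (rule SUP_least) (use * in auto)
  finally show "outer (U \<inter> A) + outer (A - U) \<le> inner V" .
qed

text \<open>Caratheodory's lemma gives a measure on the sets that split every set additively; these
  contain the open sets by \<open>outer_split\<close>, hence the Borel sets.\<close>

lemma measure_space_outer: "measure_space UNIV (sets borel) outer"
proof -
  interpret P: sigma_algebra "UNIV :: 'a set" "Pow UNIV" by (rule sigma_algebra_Pow)
  let ?L = "lambda_system UNIV (Pow UNIV) outer"
  have L: "measure_space UNIV ?L outer"
    by (rule P.caratheodory_lemma)
      (auto simp: outer_measure_space_def positive_def increasing_def countably_subadditive_def
        outer_empty outer_mono outer_countably_subadditive)
  then interpret S: sigma_algebra UNIV ?L by (simp add: measure_space_def)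
  have "U \<in> ?L" if U: "open U" for U
  proof -
    have "outer (U \<inter> A) + outer ((UNIV - U) \<inter> A) = outer A" for A
    proof (rule antisym)
      have "(UNIV - U) \<inter> A = A - U" by auto
      then show "outer (U \<inter> A) + outer ((UNIV - U) \<inter> A) \<le> outer A" using outer_split[OF U] by simp
      have "A = U \<inter> A \<union> ((UNIV - U) \<inter> A)" by auto
      then show "outer A \<le> outer (U \<inter> A) + outer ((UNIV - U) \<inter> A)" using outer_subadditive by metis
    qed
    then show ?thesis by (simp add: lambda_system_def)
  qed
  then have "sigma_sets UNIV {U. open U} \<subseteq> ?L" by (intro S.sigma_sets_subset) blast
  moreover have "sets borel = sigma_sets UNIV {U :: 'a set. open U}" by (simp add: borel_def)
  ultimately have "sets borel \<subseteq> ?L" by blast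
  with L show ?thesis
    using measure_down[of UNIV ?L outer "sets borel"] sets.sigma_algebra_axioms[of "borel :: 'a measure"]
    by simp
qed

section \<open>The invariant Borel measure\<close>

definition extension :: "'a measure" where
  "extension = measure_of UNIV (sets borel) outer"

lemma sets_extension: "sets extension = sets borel"
  unfolding extension_def by (metis sets.sets_measure_of_eq space_borel)

lemma space_extension: "space extension = UNIV"
  using sets_eq_imp_space_eq[OF sets_extension] by simp

lemma emeasure_extension: "A \<in> sets borel \<Longrightarrow> emeasure extension A = outer A"
  unfolding extension_def using measure_space_outer
  by (subst emeasure_measure_of_sigma) (auto simp: measure_space_def)

text \<open>Preimages under \<open>\<sigma>\<close> and its inverse preserve open and closed sets,
  so invariance of \<open>m\<close> passes through both approximations.\<close>

lemma outer_vimage: "outer (\<sigma> -` A) = outer A"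
proof -
  obtain \<tau> where hm: "homeomorphic_maps euclidean euclidean \<sigma> \<tau>"
    using homeo homeomorphic_map_maps by blast
  then have cont: "continuous_on UNIV \<sigma>" "continuous_on UNIV \<tau>"
    and inv: "\<tau> (\<sigma> x) = x" "\<sigma> (\<tau> x) = x" for x
    by (auto simp: homeomorphic_maps_def)
  have op: "open (f -` U)" if "open U" "f = \<sigma> \<or> f = \<tau>" for f U
    using that cont by (auto simp: open_vimage)
  have cl: "closed (f -` U)" if "closed U" "f = \<sigma> \<or> f = \<tau>" for f U
    using that cont by (auto simp: closed_vimage)
  have inner: "inner (\<sigma> -` U) = inner U" for U
  proof (intro antisym inner_leI)
    fix L assume L: "closed L" "L \<subseteq> \<sigma> -` U"
    have "\<sigma> -` (\<tau> -` L) = L" using inv by auto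
    then have "m L = m (\<tau> -` L)" using invariant[of "\<tau> -` L"] by simp
    moreover have "\<tau> -` L \<subseteq> U" using L inv by force
    ultimately show "ennreal (m L) \<le> inner U" using cl[OF L(1)] by (simp add: le_inner)
  next
    fix L assume L: "closed L" "L \<subseteq> U"
    then show "ennreal (m L) \<le> inner (\<sigma> -` U)"
      using le_inner[of "\<sigma> -` L" "\<sigma> -` U"] cl[OF L(1)] invariant[of L] by auto
  qed
  show ?thesis
  proof (intro antisym outer_geI)
    fix U assume U: "open U" "A \<subseteq> U"
    then show "outer (\<sigma> -` A) \<le> inner U"
      using outer_le_inner[of "\<sigma> -` U" "\<sigma> -` A"] op inner by auto
  next
    fix U assume U: "open U" "\<sigma> -` A \<subseteq> U"
    have "A \<subseteq> \<tau> -` U" using U inv by force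
    moreover have "\<sigma> -` (\<tau> -` U) = U" using inv by auto
    ultimately show "outer A \<le> inner U"
      using outer_le_inner[of "\<tau> -` U" A] op[OF U(1)] inner[of "\<tau> -` U"] by auto
  qed
qed

lemma extension_invariant: "extension \<in> invariant_prob_measures \<sigma>"
proof -
  have "continuous_on UNIV \<sigma>" using homeo by (simp add: homeomorphic_eq_everything_map)
  then have meas: "\<sigma> \<in> measurable extension borel"
    by (simp add: borel_measurable_continuous_onI measurable_cong_sets[OF sets_extension refl])
  have "prob_space extension"
    by (rule prob_spaceI) (simp add: space_extension emeasure_extension outer_UNIV)
  moreover have "distr extension borel \<sigma> = extension"
  proof (rule measure_eqI)
    fix A assume "A \<in> sets (distr extension borel \<sigma>)"
    then have A: "A \<in> sets borel" by simp
    have "\<sigma> -` A \<in> sets borel"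
      using measurable_sets[OF meas A] by (simp add: sets_extension space_extension)
    with A meas show "emeasure (distr extension borel \<sigma>) A = emeasure extension A"
      by (simp add: emeasure_distr space_extension emeasure_extension outer_vimage)
  qed (simp add: sets_extension)
  ultimately show ?thesis by (simp add: invariant_prob_measures_def sets_extension)
qed

text \<open>The content of a closed set bounds from below the measure of an open set around it. So
  \<open>F\<close> is exhausted by closed sets \<open>L\<close>, whereas for \<open>E\<close> the
  single closed set \<open>K\<close> suffices.\<close>

lemma extension_ratio:
  assumes F: "open F" and E: "open E" and K: "closed K" "K \<subseteq> E" and c: "0 \<le> c"
    and le: "\<And>L. closed L \<Longrightarrow> L \<subseteq> F \<Longrightarrow> m L \<le> c * m K"
  shows "measure extension F \<le> c * measure extension E"
proof -
  interpret prob_space extension using extension_invariant by (simp add: invariant_prob_measures_def)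
  have "emeasure extension F = inner F" using F by (simp add: emeasure_extension outer_open)
  also have "\<dots> \<le> ennreal (c * m K)" by (intro inner_leI ennreal_leI le)
  finally have F': "measure extension F \<le> c * m K"
    using c nonneg[of K] by (simp add: emeasure_eq_measure)
  have "ennreal (m K) \<le> emeasure extension E"
    using E K by (simp add: emeasure_extension outer_open le_inner)
  then have "m K \<le> measure extension E" by (simp add: emeasure_eq_measure)
  with F' c show ?thesis by (meson mult_left_mono order_trans)
qed

end

section \<open>Empirical measures and their cluster points\<close>

text \<open>The starting point \<open>x N\<close> varies with the length, and \<open>Suc N\<close>
  keeps the denominator positive.\<close>

definition empirical :: "('a \<Rightarrow> 'a) \<Rightarrow> (nat \<Rightarrow> 'a) \<Rightarrow> nat \<Rightarrow> 'a set \<Rightarrow> real" where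
  "empirical \<sigma> x N A = (\<Sum>i<Suc N. indicat_real A ((\<sigma> ^^ i) (x N))) / Suc N"

lemma empirical_bounds: "0 \<le> empirical \<sigma> x N A" "empirical \<sigma> x N A \<le> 1"
proof -
  have "(\<Sum>i<Suc N. indicat_real A ((\<sigma> ^^ i) (x N))) \<le> (\<Sum>i<Suc N. 1)"
    by (intro sum_mono) (auto simp: indicator_def)
  then show "empirical \<sigma> x N A \<le> 1" by (simp add: empirical_def divide_le_eq)
qed (simp add: empirical_def sum_nonneg)

lemma empirical_UNIV: "empirical \<sigma> x N UNIV = 1"
  by (simp add: empirical_def)

lemma empirical_Un: "A \<inter> B = {} \<Longrightarrow> empirical \<sigma> x N (A \<union> B) = empirical \<sigma> x N A + empirical \<sigma> x N B"
  by (simp add: empirical_def add_divide_distrib[symmetric] sum.distrib[symmetric] indicator_disj_union del: sum.lessThan_Suc)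

text \<open>Passing to the preimage shifts the orbit segment by one step, so the difference
  telescopes to its two ends.\<close>

lemma empirical_vimage: "\<bar>empirical \<sigma> x N (\<sigma> -` A) - empirical \<sigma> x N A\<bar> \<le> 1 / Suc N"
proof -
  let ?f = "\<lambda>i. indicat_real A ((\<sigma> ^^ i) (x N))"
  have "indicat_real (\<sigma> -` A) ((\<sigma> ^^ i) (x N)) = ?f (Suc i)" for i by (simp add: indicator_def)
  then have "empirical \<sigma> x N (\<sigma> -` A) - empirical \<sigma> x N A = (\<Sum>i<Suc N. ?f (Suc i) - ?f i) / Suc N"
    by (simp only: empirical_def diff_divide_distrib[symmetric] sum_subtractf[symmetric])
  also have "\<dots> = (?f (Suc N) - ?f 0) / Suc N" by (simp only: sum_lessThan_telescope[of ?f])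
  finally show ?thesis by (simp add: divide_right_mono indicator_def)
qed

lemma empirical_cluster_point:
  fixes \<sigma> :: "'a::metric_space \<Rightarrow> 'a"
  assumes compact_UNIV: "compact (UNIV :: 'a set)"
    and homeo: "homeomorphic_map euclidean euclidean \<sigma>"
  shows "\<exists>m. invariant_content \<sigma> m \<and> (\<forall>A B c.
    (\<forall>\<^sub>F N in sequentially. empirical \<sigma> x N A \<le> c * empirical \<sigma> x N B) \<longrightarrow> m A \<le> c * m B)"
proof -
  \<comment> \<open>Tychonoff's theorem: the empirical measures, as functions on the full power set,
    lie in a compact product of unit intervals.\<close>
  let ?S = "PiE UNIV (\<lambda>_ :: 'a set. {0..1 :: real})"
  have "compact ?S"
    using compactin_PiE[of "\<lambda>_. euclidean" UNIV "\<lambda>_ :: 'a set. {0..1 :: real}"]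
    by (simp add: euclidean_product_topology)
  moreover have "\<forall>\<^sub>F f in filtermap (empirical \<sigma> x) sequentially. f \<in> ?S"
    by (simp add: eventually_filtermap PiE_iff empirical_bounds)
  moreover have "filtermap (empirical \<sigma> x) sequentially \<noteq> bot"
    by (simp add: filtermap_bot_iff)
  ultimately obtain m where "inf (nhds m) (filtermap (empirical \<sigma> x) sequentially) \<noteq> bot"
    unfolding compact_filter by blast
  \<comment> \<open>A filter replaces a convergent subsequence. Along \<open>G\<close> evaluation at
    each set converges to \<open>m\<close>, and whatever holds for all large \<open>N\<close> holds
    eventually.\<close>
  moreover define G where "G = inf (nhds m) (filtermap (empirical \<sigma> x) sequentially)"
  ultimately have G: "G \<noteq> bot" "G \<le> nhds m" "G \<le> filtermap (empirical \<sigma> x) sequentially"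
    by simp_all
  have lim: "((\<lambda>f. f A) \<longlongrightarrow> m A) G" for A
  proof -
    have "((\<lambda>f. f A) \<longlongrightarrow> m A) (nhds m)"
    proof (rule topological_tendstoI)
      fix T assume "open T" "m A \<in> T"
      then show "\<forall>\<^sub>F f in nhds m. f A \<in> T"
        using open_vimage[OF \<open>open T\<close> continuous_on_product_coordinates[of A]]
        unfolding eventually_nhds by (intro exI[of _ "(\<lambda>f. f A) -` T"]) auto
    qed
    then show ?thesis using G(2) by (rule tendsto_mono[rotated])
  qed
  have ev: "eventually P G" if "\<forall>\<^sub>F N in sequentially. P (empirical \<sigma> x N)" for P
    using filter_leD[OF G(3), of P] that by (simp add: eventually_filtermap)
  have "invariant_content \<sigma> m"
  proof
    fix A B :: "'a set"
    show "0 \<le> m A"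
      by (rule tendsto_lowerbound[OF lim ev G(1)]) (simp add: empirical_bounds)
    have "\<forall>\<^sub>F f in G. f UNIV = 1" by (rule ev) (simp add: empirical_UNIV)
    then have "((\<lambda>f. f UNIV) \<longlongrightarrow> 1) G" by (rule tendsto_eventually)
    then show "m UNIV = 1" by (rule tendsto_unique[OF G(1) lim])
    show "m (A \<union> B) = m A + m B" if "A \<inter> B = {}"
    proof -
      have "\<forall>\<^sub>F f in G. f (A \<union> B) = f A + f B" by (rule ev) (simp add: empirical_Un that)
      then have "((\<lambda>f. f A + f B) \<longlongrightarrow> m (A \<union> B)) G"
        by (rule Lim_transform_eventually[OF lim])
      then show ?thesis by (rule tendsto_unique[OF G(1) _ tendsto_add[OF lim lim]])
    qed
    have "\<bar>m (\<sigma> -` A) - m A\<bar> \<le> e" if "e > 0" for e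
    proof (rule tendsto_upperbound[OF tendsto_rabs[OF tendsto_diff[OF lim lim]] ev G(1)])
      have "\<forall>\<^sub>F N in sequentially. 1 / real (Suc N) < e"
        using order_tendstoD(2)[OF LIMSEQ_inverse_real_of_nat that] by (simp add: inverse_eq_divide)
      then show "\<forall>\<^sub>F N in sequentially. \<bar>empirical \<sigma> x N (\<sigma> -` A) - empirical \<sigma> x N A\<bar> \<le> e"
      proof (rule eventually_mono)
        fix N assume "1 / real (Suc N) < e"
        then show "\<bar>empirical \<sigma> x N (\<sigma> -` A) - empirical \<sigma> x N A\<bar> \<le> e"
          using empirical_vimage[of \<sigma> x N A] by linarith
      qed
    qed
    then have "\<bar>m (\<sigma> -` A) - m A\<bar> \<le> 0" by (rule field_le_epsilon) simp
    then show "m (\<sigma> -` A) = m A" by simp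
  qed fact+
  moreover have "m A \<le> c * m B"
    if "\<forall>\<^sub>F N in sequentially. empirical \<sigma> x N A \<le> c * empirical \<sigma> x N B" for A B c
    by (rule tendsto_le[OF G(1) tendsto_mult_left[OF lim] lim ev[OF that]])
  ultimately show ?thesis by blast
qed

section \<open>Dynamical comparison\<close>

definition birkhoff_sum :: "('a \<Rightarrow> 'a) \<Rightarrow> ('a \<Rightarrow> real) \<Rightarrow> nat \<Rightarrow> 'a \<Rightarrow> real" where
  "birkhoff_sum \<sigma> f n x = (\<Sum>i<n. f ((\<sigma> ^^ i) x))"

lemma birkhoff_sum_0: "birkhoff_sum \<sigma> f 0 x = 0"
  by (simp add: birkhoff_sum_def)

lemma birkhoff_sum_Suc: "birkhoff_sum \<sigma> f (Suc n) x = birkhoff_sum \<sigma> f n x + f ((\<sigma> ^^ n) x)"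
  by (simp add: birkhoff_sum_def)

lemma birkhoff_sum_add:
  "birkhoff_sum \<sigma> f (m + n) x = birkhoff_sum \<sigma> f m x + birkhoff_sum \<sigma> f n ((\<sigma> ^^ m) x)"
proof (induction n)
  case (Suc n)
  have "(\<sigma> ^^ (m + n)) x = (\<sigma> ^^ n) ((\<sigma> ^^ m) x)" by (metis add.commute comp_apply funpow_add)
  with Suc show ?case by (simp add: birkhoff_sum_Suc)
qed (simp add: birkhoff_sum_0)

lemma birkhoff_sum_shift: "birkhoff_sum \<sigma> f n (\<sigma> x) = birkhoff_sum \<sigma> f (Suc n) x - f x"
  using birkhoff_sum_add[of \<sigma> f 1 n x] by (simp add: birkhoff_sum_def)

lemma continuous_on_funpow:
  fixes \<sigma> :: "'a::topological_space \<Rightarrow> 'a"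
  shows "continuous_on UNIV \<sigma> \<Longrightarrow> continuous_on UNIV (\<sigma> ^^ n)"
proof (induction n)
  case (Suc n)
  then show ?case using continuous_on_compose2[of UNIV \<sigma> UNIV "\<sigma> ^^ n"] by (simp add: o_def)
qed (simp add: id_def)

lemma continuous_on_birkhoff_sum:
  fixes \<sigma> :: "'a::topological_space \<Rightarrow> 'a"
  assumes "continuous_on UNIV \<sigma>" "continuous_on UNIV f"
  shows "continuous_on UNIV (birkhoff_sum \<sigma> f n)"
  unfolding birkhoff_sum_def[abs_def]
  by (intro continuous_on_sum continuous_on_compose2[OF assms(2)] continuous_on_funpow assms(1)) simp

text \<open>If every length failed at some point \<open>x n\<close>, the empirical measures along
  these segments would yield an invariant measure violating \<open>meas\<close>. The slope
  \<open>Suc n\<close> grows with the length so that the truncations eventually dominate the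
  indicator of each closed subset of \<open>F\<close>.\<close>

lemma birkhoff_sums_dominated:
  fixes \<sigma> :: "'a::metric_space \<Rightarrow> 'a" and \<phi> f :: "'a \<Rightarrow> real"
  assumes compact_UNIV: "compact (UNIV :: 'a set)"
    and homeo: "homeomorphic_map euclidean euclidean \<sigma>"
    and E: "open E" and F: "open F" and K: "closed K" "K \<subseteq> E"
    and meas: "\<And>\<mu>. \<mu> \<in> invariant_prob_measures \<sigma> \<Longrightarrow> c * measure \<mu> E < measure \<mu> F"
    and c: "0 \<le> c"
    and supp: "open_support_function F \<phi>"
    and f: "\<And>x. f x \<le> indicat_real K x"
  shows "\<exists>n. \<forall>x. c * birkhoff_sum \<sigma> f (Suc n) x
    < birkhoff_sum \<sigma> (\<lambda>y. min 1 (Suc n * \<phi> y)) (Suc n) x"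
proof (rule ccontr)
  assume "\<not> ?thesis"
  then have "\<forall>n. \<exists>x. birkhoff_sum \<sigma> (\<lambda>y. min 1 (Suc n * \<phi> y)) (Suc n) x \<le> c * birkhoff_sum \<sigma> f (Suc n) x"
    by (simp add: not_less)
  then obtain x where x: "\<And>n. birkhoff_sum \<sigma> (\<lambda>y. min 1 (Suc n * \<phi> y)) (Suc n) (x n)
      \<le> c * birkhoff_sum \<sigma> f (Suc n) (x n)"
    by metis
  obtain m where m: "invariant_content \<sigma> m"
    "\<And>A B c. (\<forall>\<^sub>F N in sequentially. empirical \<sigma> x N A \<le> c * empirical \<sigma> x N B) \<Longrightarrow> m A \<le> c * m B"
    using empirical_cluster_point[OF compact_UNIV homeo, of x] by auto
  interpret invariant_content \<sigma> m by (rule m(1))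
  have "m L \<le> c * m K" if L: "closed L" "L \<subseteq> F" for L
  proof (rule m(2))
    have "compact L" using compact_UNIV L(1) by (metis Int_UNIV_left compact_Int_closed)
    have \<phi>: "continuous_on L \<phi>" "\<And>y. 0 \<le> \<phi> y" "\<And>y. y \<in> L \<Longrightarrow> 0 < \<phi> y"
      using supp L(2) unfolding open_support_function_def by (auto intro: continuous_on_subset)
    obtain d where d: "d > 0" "\<And>y. y \<in> L \<Longrightarrow> d \<le> \<phi> y"
    proof (cases "L = {}")
      case False
      then obtain y where "y \<in> L" "\<And>z. z \<in> L \<Longrightarrow> \<phi> y \<le> \<phi> z"
        using continuous_attains_inf[OF \<open>compact L\<close> False \<phi>(1)] by blast
      then show ?thesis using \<phi>(3) that by blast
    qed (use that[of 1] in simp)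
    \<comment> \<open>As \<open>\<phi>\<close> is at least \<open>d\<close> on \<open>L\<close>, the
      truncation with slope \<open>Suc N\<close> equals 1 on \<open>L\<close> from here on.\<close>
    have "\<forall>\<^sub>F N in sequentially. 1 / d \<le> real N"
      using filterlim_real_sequentially by (simp add: filterlim_at_top)
    then show "\<forall>\<^sub>F N in sequentially. empirical \<sigma> x N L \<le> c * empirical \<sigma> x N K"
    proof (rule eventually_mono)
      fix N assume "1 / d \<le> real N"
      then have N: "1 \<le> Suc N * d" using d(1) by (simp add: divide_le_eq algebra_simps)
      have "indicat_real L y \<le> min 1 (Suc N * \<phi> y)" for y
      proof (cases "y \<in> L")
        case True
        then have "Suc N * d \<le> Suc N * \<phi> y" using d(2) by (intro mult_left_mono) auto
        with N have "1 \<le> Suc N * \<phi> y" by linarith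
        with True show ?thesis by (simp add: indicator_def)
      qed (use \<phi>(2) in simp)
      then have "(\<Sum>i<Suc N. indicat_real L ((\<sigma> ^^ i) (x N)))
          \<le> birkhoff_sum \<sigma> (\<lambda>y. min 1 (Suc N * \<phi> y)) (Suc N) (x N)"
        unfolding birkhoff_sum_def by (intro sum_mono)
      also have "\<dots> \<le> c * birkhoff_sum \<sigma> f (Suc N) (x N)" by (rule x)
      also have "\<dots> \<le> c * (\<Sum>i<Suc N. indicat_real K ((\<sigma> ^^ i) (x N)))"
        unfolding birkhoff_sum_def by (intro mult_left_mono sum_mono f c)
      finally show "empirical \<sigma> x N L \<le> c * empirical \<sigma> x N K"
        unfolding empirical_def times_divide_eq_right by (intro divide_right_mono) auto
    qed
  qed
  then have "measure extension F \<le> c * measure extension E"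
    by (rule extension_ratio[OF F E K c])
  then show False using meas[OF extension_invariant] by simp
qed

text \<open>With \<open>h\<close> the average of the Birkhoff sums of lengths 0 to \<open>n\<close>,
  the expression \<open>g x + h (\<sigma> x) - h x\<close> telescopes to the Birkhoff sum of length
  \<open>Suc n\<close> divided by \<open>Suc n\<close>.\<close>

lemma transfer_function:
  fixes \<sigma> :: "'a::metric_space \<Rightarrow> 'a"
  assumes compact_UNIV: "compact (UNIV :: 'a set)"
    and \<sigma>: "continuous_on UNIV \<sigma>" and g: "continuous_on UNIV g"
    and pos: "\<And>x. 0 \<le> birkhoff_sum \<sigma> g (Suc n) x"
  shows "\<exists>h. continuous_on UNIV h \<and> (\<forall>x. 0 \<le> h x \<and> h x \<le> g x + h (\<sigma> x))"
proof -
  define h where "h x = (\<Sum>j<Suc n. birkhoff_sum \<sigma> g j x) / Suc n" for x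
  have h: "continuous_on UNIV h"
    unfolding h_def[abs_def] by (intro continuous_intros continuous_on_birkhoff_sum \<sigma> g) simp
  obtain z where z: "\<And>x. h z \<le> h x"
    using continuous_attains_inf[OF compact_UNIV _ h] by auto
  have "h x \<le> g x + h (\<sigma> x)" for x
  proof -
    have "h (\<sigma> x) = ((\<Sum>j<Suc n. birkhoff_sum \<sigma> g (Suc j) x) - Suc n * g x) / Suc n"
      by (simp add: h_def birkhoff_sum_shift sum_subtractf del: sum.lessThan_Suc)
    also have "\<dots> = (\<Sum>j<Suc n. birkhoff_sum \<sigma> g (Suc j) x) / Suc n - g x"
      by (simp add: diff_divide_distrib del: sum.lessThan_Suc of_nat_Suc)
    finally have "g x + h (\<sigma> x) - h x
        = (\<Sum>j<Suc n. birkhoff_sum \<sigma> g (Suc j) x - birkhoff_sum \<sigma> g j x) / Suc n"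
      by (simp add: h_def sum_subtractf diff_divide_distrib del: sum.lessThan_Suc of_nat_Suc)
    also have "\<dots> = birkhoff_sum \<sigma> g (Suc n) x / Suc n"
      by (simp only: sum_lessThan_telescope[of "\<lambda>j. birkhoff_sum \<sigma> g j x"] birkhoff_sum_0 diff_zero)
    also have "\<dots> \<ge> 0" using pos by simp
    finally show ?thesis by simp
  qed
  \<comment> \<open>Subtracting the minimum makes the function nonnegative and leaves the inequality
    unchanged, as constants cancel.\<close>
  then show ?thesis using h z by (intro exI[of _ "\<lambda>x. h x - h z"] conjI continuous_intros) auto
qed

text \<open>Place the points \<open>(\<sigma> ^^ k) x\<close> of an orbit on the real line at the positions
  \<open>birkhoff_sum \<sigma> f k x\<close>, and attach to \<open>x\<close> the interval from \<open>h x\<close> to \<open>h x + 2 * e x\<close>.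
  The inequality for \<open>h\<close> says that the intervals of the successive points of the orbit do not
  overlap, so every point of the orbit is interior to at most one of them.\<close>

locale matching =
  fixes \<sigma> :: "'a \<Rightarrow> 'a" and e f h :: "'a \<Rightarrow> real"
  assumes inj: "inj \<sigma>"
    and e_nonneg: "0 \<le> e x" and f_le_1: "f x \<le> 1"
    and h_nonneg: "0 \<le> h x" and h_transfer: "h x + 2 * e x \<le> f x + h (\<sigma> x)"
begin

definition weight :: "nat \<Rightarrow> 'a \<Rightarrow> real" where
  "weight k x = max 0 (min (birkhoff_sum \<sigma> f k x - h x) (h x + 2 * e x - birkhoff_sum \<sigma> f k x))"

lemma weight_nonneg: "0 \<le> weight k x"
  by (simp add: weight_def)

lemma weight_pos_iff:
  "weight k x \<noteq> 0 \<longleftrightarrow> h x < birkhoff_sum \<sigma> f k x \<and> birkhoff_sum \<sigma> f k x < h x + 2 * e x"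
  by (auto simp: weight_def max_def min_def)

text \<open>Telescoping \<open>h_transfer\<close> along the orbit and dropping the nonnegative
  intermediate terms \<open>2 * e\<close>. In coordinates based at \<open>x\<close>, the right side
  is the left end of the interval of \<open>(\<sigma> ^^ Suc j) x\<close>.\<close>

lemma h_birkhoff: "h x + 2 * e x \<le> birkhoff_sum \<sigma> f (Suc j) x + h ((\<sigma> ^^ Suc j) x)"
proof (induction j)
  case 0
  then show ?case using h_transfer[of x] by (simp add: birkhoff_sum_def)
next
  case (Suc j)
  then show ?case
    using h_transfer[of "(\<sigma> ^^ Suc j) x"] e_nonneg[of "(\<sigma> ^^ Suc j) x"]
    by (simp add: birkhoff_sum_Suc)
qed

text \<open>If \<open>k\<close> exceeded \<open>l\<close>, injectivity would make \<open>y\<close> a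
  later point of the orbit of \<open>x\<close>. The common image would then lie inside the intervals
  of both points, which \<open>h_birkhoff\<close> separates.\<close>

lemma weight_disjoint:
  assumes "weight k x \<noteq> 0" "weight l y \<noteq> 0" "(\<sigma> ^^ k) x = (\<sigma> ^^ l) y"
  shows "k = l"
proof -
  have *: "k \<le> l" if w: "weight k x \<noteq> 0" "weight l y \<noteq> 0" and eq: "(\<sigma> ^^ k) x = (\<sigma> ^^ l) y" for k l x y
  proof (rule ccontr)
    assume "\<not> k \<le> l"
    then obtain j where k: "k = Suc j + l" by (metis add.commute add_Suc less_imp_Suc_add not_le)
    have "(\<sigma> ^^ l) ((\<sigma> ^^ Suc j) x) = (\<sigma> ^^ l) y" using eq by (metis k add.commute comp_apply funpow_add)
    then have y: "y = (\<sigma> ^^ Suc j) x" using inj_fn[OF inj, of l] by (metis injD)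
    have "birkhoff_sum \<sigma> f k x = birkhoff_sum \<sigma> f (Suc j) x + birkhoff_sum \<sigma> f l y"
      unfolding k y by (rule birkhoff_sum_add)
    then show False using w h_birkhoff[of x j] unfolding weight_pos_iff y by linarith
  qed
  show ?thesis using *[OF assms] *[OF assms(2,1) assms(3)[symmetric]] by simp
qed

text \<open>The last point of the orbit at distance at most 1 to the right of \<open>h x\<close> lies strictly
  beyond \<open>h x\<close>, as the steps are at most 1, and it carries mass, as the next point is further
  right.\<close>

lemma weight_exists:
  assumes ex: "e x = 1" and unbounded: "\<And>r. \<exists>k. r < birkhoff_sum \<sigma> f k x"
  shows "\<exists>k. weight k x \<noteq> 0 \<and> 0 < f ((\<sigma> ^^ k) x)"
proof -
  define k where "k = (LEAST k. h x + 1 < birkhoff_sum \<sigma> f k x)"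
  have k: "h x + 1 < birkhoff_sum \<sigma> f k x"
    unfolding k_def by (rule LeastI_ex[OF unbounded])
  have "k \<noteq> 0"
  proof
    assume "k = 0"
    with k h_nonneg[of x] show False by (simp add: birkhoff_sum_0)
  qed
  then obtain l where l: "k = Suc l" using not0_implies_Suc by blast
  have "birkhoff_sum \<sigma> f l x \<le> h x + 1"
    using not_less_Least[of l "\<lambda>k. h x + 1 < birkhoff_sum \<sigma> f k x"] l unfolding k_def by simp
  then show ?thesis
    using k f_le_1[of "(\<sigma> ^^ l) x"] unfolding l birkhoff_sum_Suc weight_pos_iff ex by (intro exI[of _ l]) auto
qed

end

text \<open>\<open>v\<close> and \<open>w\<close> become the coefficients of the outer factors in
  the Cuntz subequivalence: the second clause removes off-diagonal terms, the third puts the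
  diagonal near \<open>\<phi>\<close>.\<close>

lemma dynamical_comparison:
  fixes \<sigma> :: "'a::metric_space \<Rightarrow> 'a"
  assumes compact_UNIV: "compact (UNIV :: 'a set)"
    and homeo: "homeomorphic_map euclidean euclidean \<sigma>"
    and E: "open E" and F: "open F"
    and meas: "\<And>\<mu>. \<mu> \<in> invariant_prob_measures \<sigma> \<Longrightarrow> 2 * measure \<mu> E < measure \<mu> F"
    and suppE: "open_support_function E \<phi>"
    and suppF: "open_support_function F \<psi>"
    and \<epsilon>: "0 < \<epsilon>"
  shows "\<exists>(M :: nat) v w. (\<forall>k. continuous_on UNIV (v k) \<and> continuous_on UNIV (w k)) \<and>
    (\<forall>k l x y. v k x \<noteq> 0 \<longrightarrow> w l y \<noteq> 0 \<longrightarrow> (\<sigma> ^^ k) x = (\<sigma> ^^ l) y \<longrightarrow> k = l) \<and>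
    (\<forall>x. \<bar>(\<Sum>k<M. v k x * \<psi> ((\<sigma> ^^ k) x) * w k x) - \<phi> x\<bar> \<le> \<epsilon>)"
proof -
  have \<phi>: "continuous_on UNIV \<phi>" "\<And>x. 0 \<le> \<phi> x" "\<And>x. x \<in> E \<longleftrightarrow> 0 < \<phi> x"
    using suppE by (auto simp: open_support_function_def)
  have \<psi>: "continuous_on UNIV \<psi>" "\<And>x. 0 \<le> \<psi> x" "\<And>x. x \<in> F \<longleftrightarrow> 0 < \<psi> x"
    using suppF by (auto simp: open_support_function_def)
  have \<sigma>: "continuous_on UNIV \<sigma>" "inj \<sigma>"
    using homeo by (auto simp: homeomorphic_eq_everything_map)
  \<comment> \<open>Rises from 0 at \<open>\<phi> x = \<epsilon> / 2\<close> to 1 at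
    \<open>\<phi> x = \<epsilon>\<close>, leaving room for the closed set \<open>K\<close> between
    the support of \<open>e\<close> and the complement of \<open>E\<close>.\<close>
  define e where "e x = min 1 (max 0 (2 * \<phi> x / \<epsilon> - 1))" for x
  have e: "continuous_on UNIV e" unfolding e_def[abs_def] by (intro continuous_intros \<phi>(1)) (use \<epsilon> in auto)
  have e_nonneg: "0 \<le> e x" for x by (simp add: e_def)
  have e_1: "e x = 1" if "\<epsilon> \<le> \<phi> x" for x
  proof -
    have "1 \<le> 2 * \<phi> x / \<epsilon> - 1" using that \<epsilon> by (simp add: le_divide_eq)
    then show ?thesis by (simp add: e_def)
  qed
  define K where "K = {x. \<epsilon> / 2 \<le> \<phi> x}"
  have K: "closed K" "K \<subseteq> E"
  proof -
    show "closed K" unfolding K_def by (intro closed_Collect_le continuous_on_const \<phi>(1))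
    show "K \<subseteq> E"
    proof
      fix x assume "x \<in> K"
      then have "0 < \<phi> x" using \<epsilon> by (simp add: K_def)
      then show "x \<in> E" by (simp only: \<phi>(3))
    qed
  qed
  have eK: "e x \<le> indicat_real K x" for x
  proof (cases "x \<in> K")
    case False
    then have "2 * \<phi> x / \<epsilon> \<le> 1" using \<epsilon> by (simp add: K_def divide_le_eq)
    with False show ?thesis by (simp add: e_def)
  qed (simp add: e_def)
  from birkhoff_sums_dominated[OF compact_UNIV homeo E F K meas _ suppF eK]
  have "\<exists>n. \<forall>x. 2 * birkhoff_sum \<sigma> e (Suc n) x
      < birkhoff_sum \<sigma> (\<lambda>y. min 1 (Suc n * \<psi> y)) (Suc n) x"
    by simp
  then obtain n where n: "\<And>x. 2 * birkhoff_sum \<sigma> e (Suc n) x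
      < birkhoff_sum \<sigma> (\<lambda>y. min 1 (Suc n * \<psi> y)) (Suc n) x"
    by metis
  define f where "f y = min 1 (Suc n * \<psi> y)" for y
  have f: "continuous_on UNIV f" unfolding f_def[abs_def] by (intro continuous_intros \<psi>(1))
  have f_le_1: "f x \<le> 1" for x by (simp add: f_def)
  have f_pos: "0 < \<psi> x" if "0 < f x" for x using that \<psi>(2)[of x] by (auto simp: f_def zero_less_mult_iff)
  have gap: "2 * birkhoff_sum \<sigma> e (Suc n) x < birkhoff_sum \<sigma> f (Suc n) x" for x
    using n[of x] unfolding f_def[abs_def] .
  have "birkhoff_sum \<sigma> (\<lambda>x. f x - 2 * e x) (Suc n) x
      = birkhoff_sum \<sigma> f (Suc n) x - 2 * birkhoff_sum \<sigma> e (Suc n) x" for x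
    unfolding birkhoff_sum_def sum_subtractf sum_distrib_left ..
  then have "0 \<le> birkhoff_sum \<sigma> (\<lambda>x. f x - 2 * e x) (Suc n) x" for x
    using gap[of x] by simp
  moreover have "continuous_on UNIV (\<lambda>x. f x - 2 * e x)" by (intro continuous_intros e f)
  ultimately have "\<exists>h. continuous_on UNIV h \<and> (\<forall>x. 0 \<le> h x \<and> h x \<le> f x - 2 * e x + h (\<sigma> x))"
    by (intro transfer_function[OF compact_UNIV \<sigma>(1)])
  then obtain h where h: "continuous_on UNIV h" "\<And>x. 0 \<le> h x" "\<And>x. h x \<le> f x - 2 * e x + h (\<sigma> x)"
    by auto
  interpret matching \<sigma> e f h
  proof
    show "h x + 2 * e x \<le> f x + h (\<sigma> x)" for x using h(3)[of x] by simp
  qed (fact \<sigma>(2) e_nonneg f_le_1 h(2))+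
  have weight: "continuous_on UNIV (weight k)" for k
    unfolding weight_def[abs_def] by (intro continuous_intros continuous_on_birkhoff_sum \<sigma>(1) e f h(1))
  \<comment> \<open>By compactness the strict gap gives a uniform gain over each block of
    \<open>Suc n\<close> steps, so positions grow at least linearly and \<open>weight_exists\<close>
    applies.\<close>
  obtain d where d: "0 < d" "\<And>x. d \<le> birkhoff_sum \<sigma> f (Suc n) x"
  proof -
    obtain z where z: "\<And>x. birkhoff_sum \<sigma> f (Suc n) z \<le> birkhoff_sum \<sigma> f (Suc n) x"
      using continuous_attains_inf[OF compact_UNIV _ continuous_on_birkhoff_sum[OF \<sigma>(1) f]] by auto
    have "0 \<le> birkhoff_sum \<sigma> e (Suc n) z" unfolding birkhoff_sum_def by (intro sum_nonneg e_nonneg)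
    then show ?thesis using that[of "birkhoff_sum \<sigma> f (Suc n) z"] z gap[of z] by simp
  qed
  have linear: "q * d \<le> birkhoff_sum \<sigma> f (q * Suc n) x" for q x
  proof (induction q)
    case (Suc q)
    then show ?case
      using d(2)[of "(\<sigma> ^^ (q * Suc n)) x"] birkhoff_sum_add[of \<sigma> f "q * Suc n" "Suc n" x]
      by (simp add: algebra_simps)
  qed (simp add: birkhoff_sum_0)
  have unbounded: "\<exists>k. r < birkhoff_sum \<sigma> f k x" for r x
  proof -
    obtain q :: nat where "r < q * d" using reals_Archimedean3[OF d(1)] by blast
    then show ?thesis using linear[of q x] by (intro exI) (rule less_le_trans)
  qed
  have \<psi>\<sigma>: "continuous_on UNIV (\<lambda>x. \<psi> ((\<sigma> ^^ k) x))" for k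
    by (rule continuous_on_compose2[OF \<psi>(1) continuous_on_funpow[OF \<sigma>(1)]]) simp
  define C where "C = {x. \<epsilon> \<le> \<phi> x}"
  have "compact C"
  proof -
    have "closed C" unfolding C_def by (intro closed_Collect_le \<phi>(1) continuous_on_const)
    then show ?thesis using compact_UNIV by (metis Int_UNIV_left compact_Int_closed)
  qed
  \<comment> \<open>The points to which the \<open>k\<close>-th term contributes. They cover the
    compact set \<open>C\<close>, so finitely many terms suffice, and this fixes
    \<open>M\<close>.\<close>
  define V where "V k = {x. 0 < weight k x * \<psi> ((\<sigma> ^^ k) x)}" for k
  have "open (V k)" for k
    unfolding V_def by (intro open_Collect_less continuous_intros weight \<psi>\<sigma>)
  moreover have "C \<subseteq> (\<Union>k. V k)"
  proof
    fix x assume "x \<in> C"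
    then have "e x = 1" using e_1 by (simp add: C_def)
    then obtain k where "weight k x \<noteq> 0" "0 < \<psi> ((\<sigma> ^^ k) x)"
      using weight_exists[OF _ unbounded] f_pos by blast
    then have "x \<in> V k" using weight_nonneg[of k x] by (simp add: V_def)
    then show "x \<in> (\<Union>k. V k)" by blast
  qed
  ultimately obtain I where I: "finite I" "C \<subseteq> (\<Union>k\<in>I. V k)"
    using compactE_image[OF \<open>compact C\<close>, of UNIV V] by auto
  then obtain M where M: "I \<subseteq> {..<M}" using finite_nat_iff_bounded by blast
  \<comment> \<open>The diagonal before normalisation, with \<open>weight\<close> in both outer
    factors.\<close>
  define T where "T x = (\<Sum>k<M. weight k x * \<psi> ((\<sigma> ^^ k) x) * weight k x)" for x
  have T: "continuous_on UNIV T" unfolding T_def[abs_def] by (intro continuous_intros weight \<psi>\<sigma>)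
  have term_nonneg: "0 \<le> weight k x * \<psi> ((\<sigma> ^^ k) x) * weight k x" for k x
    by (intro mult_nonneg_nonneg weight_nonneg \<psi>)
  have T_nonneg: "0 \<le> T x" for x unfolding T_def by (intro sum_nonneg term_nonneg)
  have T_pos: "0 < T x" if x: "x \<in> C" for x
  proof -
    obtain k where k: "k < M" "x \<in> V k" using x I M by blast
    then have "0 < weight k x * \<psi> ((\<sigma> ^^ k) x) * weight k x"
      using weight_nonneg[of k x] \<psi>(2)[of "(\<sigma> ^^ k) x"] unfolding V_def
      by (auto simp: zero_less_mult_iff)
    also have "\<dots> \<le> T x" unfolding T_def using k(1) by (intro member_le_sum term_nonneg) auto
    finally show ?thesis .
  qed
  obtain r where r: "0 < r" "\<And>x. x \<in> C \<Longrightarrow> r \<le> T x"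
  proof (cases "C = {}")
    case False
    then obtain y where "y \<in> C" "\<And>z. z \<in> C \<Longrightarrow> T y \<le> T z"
      using continuous_attains_inf[OF \<open>compact C\<close> False continuous_on_subset[OF T]] by blast
    then show ?thesis using T_pos that by blast
  qed (use that[of 1] in simp)
  \<comment> \<open>The factor \<open>T x / max r (T x)\<close> is 1 on \<open>C\<close> and between
    0 and 1 elsewhere. So the diagonal equals \<open>\<phi>\<close> on \<open>C\<close>, and off
    \<open>C\<close> it lies between 0 and \<open>\<phi> x\<close>, which is below
    \<open>\<epsilon>\<close>. The maximum with \<open>r\<close> avoids division by zero.\<close>
  define v where "v k x = \<phi> x / max r (T x) * weight k x" for k x
  have sum: "(\<Sum>k<M. v k x * \<psi> ((\<sigma> ^^ k) x) * weight k x) = \<phi> x * (T x / max r (T x))" for x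
    by (simp add: v_def T_def sum_distrib_left sum_divide_distrib mult_ac)
  show ?thesis
  proof (rule exI[of _ M], rule exI[of _ v], rule exI[of _ weight], intro conjI allI impI)
    show "continuous_on UNIV (v k)" for k
      unfolding v_def[abs_def] by (intro continuous_intros \<phi>(1) T weight) (use r(1) in auto)
    show "k = l" if "v k x \<noteq> 0" "weight l y \<noteq> 0" "(\<sigma> ^^ k) x = (\<sigma> ^^ l) y" for k l x y
      using that weight_disjoint[of k x l y] by (simp add: v_def)
    show "\<bar>(\<Sum>k<M. v k x * \<psi> ((\<sigma> ^^ k) x) * weight k x) - \<phi> x\<bar> \<le> \<epsilon>" for x
    proof (cases "x \<in> C")
      case True
      then have "0 < T x" "max r (T x) = T x" using T_pos r(2) by (auto simp: max_absorb2)
      then show ?thesis using \<epsilon> unfolding sum by simp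
    next
      case False
      have q: "0 \<le> T x / max r (T x)" "T x / max r (T x) \<le> 1"
        using r(1) T_nonneg[of x] by (auto simp: divide_le_eq max_def)
      then have "0 \<le> \<phi> x * (T x / max r (T x))" "\<phi> x * (T x / max r (T x)) \<le> \<phi> x"
        using mult_nonneg_nonneg[OF \<phi>(2)[of x] q(1)] mult_left_le[OF q(2) \<phi>(2)[of x]] by blast+
      then show ?thesis using False unfolding sum C_def by simp
    qed
    show "continuous_on UNIV (weight k)" for k by (rule weight)
  qed
qed

section \<open>The crossed product\<close>

lemma int_iterate_0: "int_iterate \<sigma> 0 x = x"
  by (simp add: int_iterate_def)

lemma int_iterate_of_nat: "int_iterate \<sigma> (int k) = \<sigma> ^^ k"
  by (simp add: int_iterate_def)

lemma int_iterate_succ: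
  assumes "bij \<sigma>"
  shows "int_iterate \<sigma> (n + 1) x = \<sigma> (int_iterate \<sigma> n x)"
proof (cases "0 \<le> n")
  case True
  then have "nat (n + 1) = Suc (nat n)" by simp
  with True show ?thesis by (simp add: int_iterate_def)
next
  case False
  then have "nat (- n) = Suc (nat (- (n + 1)))" by simp
  \<comment> \<open>At \<open>n = -1\<close> the iterate \<open>n + 1\<close> already falls under
    the nonnegative branch of the definition.\<close>
  then show ?thesis
    using False surj_f_inv_f[OF bij_is_surj[OF assms]] by (cases "n = -1") (simp_all add: int_iterate_def)
qed

lemma int_iterate_add:
  assumes "bij \<sigma>"
  shows "int_iterate \<sigma> (m + n) x = int_iterate \<sigma> m (int_iterate \<sigma> n x)"
proof (induction m rule: int_induct[where k = 0])
  case (step1 i)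
  then show ?case using int_iterate_succ[OF assms, of "i + n"] int_iterate_succ[OF assms, of i]
    by (simp add: ac_simps)
next
  case (step2 i)
  \<comment> \<open>The downward step follows from the upward rule by cancelling the injective
    \<open>\<sigma>\<close>.\<close>
  have "\<sigma> (int_iterate \<sigma> (i - 1 + n) x) = \<sigma> (int_iterate \<sigma> (i - 1) (int_iterate \<sigma> n x))"
    using step2(2) int_iterate_succ[OF assms, of "i - 1 + n"] int_iterate_succ[OF assms, of "i - 1"]
    by (simp add: algebra_simps)
  then show ?case using bij_is_inj[OF assms] by (simp add: inj_eq)
qed (simp add: int_iterate_0)

lemma int_iterate_uminus: "bij \<sigma> \<Longrightarrow> int_iterate \<sigma> (- n) (int_iterate \<sigma> n x) = x"
  "bij \<sigma> \<Longrightarrow> int_iterate \<sigma> n (int_iterate \<sigma> (- n) x) = x"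
  using int_iterate_add[of \<sigma> "- n" n x] int_iterate_add[of \<sigma> n "- n" x] by (simp_all add: int_iterate_0)

lemma continuous_on_int_iterate:
  assumes "homeomorphic_map euclidean euclidean \<sigma>"
  shows "continuous_on UNIV (int_iterate \<sigma> n)"
proof -
  obtain \<tau> where \<tau>: "homeomorphic_maps euclidean euclidean \<sigma> \<tau>"
    using assms homeomorphic_map_maps by blast
  then have "inv_into UNIV \<sigma> = \<tau>"
    by (intro inv_equality) (auto simp: homeomorphic_maps_def)
  with \<tau> show ?thesis
    by (simp add: int_iterate_def homeomorphic_maps_def continuous_on_funpow)
qed

locale compact_homeo =
  fixes \<sigma> :: "'a::metric_space \<Rightarrow> 'a"
  assumes compact_UNIV: "compact (UNIV :: 'a set)"
    and homeo: "homeomorphic_map euclidean euclidean \<sigma>"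
begin

abbreviation P where "P \<equiv> finsupp_crossed_product \<sigma>"

abbreviation T where "T \<equiv> int_iterate \<sigma>"

lemma bij: "bij \<sigma>"
  using homeo by (auto simp: homeomorphic_eq_everything_map bij_def)

section \<open>The *-algebra of finite sums\<close>

definition supp :: "(int \<Rightarrow> 'a \<Rightarrow> complex) \<Rightarrow> int set" where
  "supp a = {n. a n \<noteq> (\<lambda>x. 0)}"

lemma supp_outside: "n \<notin> supp a \<Longrightarrow> a n x = 0"
  by (simp add: supp_def)

lemma supp_subsetI: "(\<And>n x. n \<notin> S \<Longrightarrow> a n x = 0) \<Longrightarrow> supp a \<subseteq> S"
  by (auto simp: supp_def)

lemma carrier_iff: "a \<in> carrier P \<longleftrightarrow> finite (supp a) \<and> (\<forall>n. continuous_on UNIV (a n))"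
  by (simp add: finsupp_crossed_product_def supp_def)

lemma carrierI:
  "finite S \<Longrightarrow> supp a \<subseteq> S \<Longrightarrow> (\<And>n. continuous_on UNIV (a n)) \<Longrightarrow> a \<in> carrier P"
  unfolding carrier_iff by (auto intro: finite_subset)

lemma finite_supp: "a \<in> carrier P \<Longrightarrow> finite (supp a)"
  by (simp add: carrier_iff)

lemma continuous: "a \<in> carrier P \<Longrightarrow> continuous_on UNIV (a n)"
  by (simp add: carrier_iff)

lemma P_simps:
  "\<zero>\<^bsub>P\<^esub> = (\<lambda>n x. 0)" "\<one>\<^bsub>P\<^esub> = (\<lambda>n x. if n = 0 then 1 else 0)"
  "a \<oplus>\<^bsub>P\<^esub> b = (\<lambda>n x. a n x + b n x)" "c \<odot>\<^bsub>P\<^esub> a = (\<lambda>n x. c * a n x)"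
  by (simp_all add: finsupp_crossed_product_def)

text \<open>Summing over any finite superset of the support lets products of different elements
  share one index set.\<close>

lemma mult_eq:
  assumes "finite S" "supp a \<subseteq> S"
  shows "(a \<otimes>\<^bsub>P\<^esub> b) n x = (\<Sum>k\<in>S. a k x * b (n - k) (T (- k) x))"
proof -
  have "(a \<otimes>\<^bsub>P\<^esub> b) n x = (\<Sum>k\<in>supp a. a k x * b (n - k) (T (- k) x))"
    by (simp add: finsupp_crossed_product_def supp_def)
  also have "\<dots> = (\<Sum>k\<in>S. a k x * b (n - k) (T (- k) x))"
    by (rule sum.mono_neutral_left) (use assms in \<open>auto simp: supp_outside\<close>)
  finally show ?thesis .
qed

abbreviation sumset :: "int set \<Rightarrow> int set \<Rightarrow> int set" where
  "sumset A B \<equiv> (\<lambda>(k, j). k + j) ` (A \<times> B)"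

lemma supp_mult:
  assumes "a \<in> carrier P"
  shows "supp (a \<otimes>\<^bsub>P\<^esub> b) \<subseteq> sumset (supp a) (supp b)"
proof (rule supp_subsetI)
  fix n x assume n: "n \<notin> sumset (supp a) (supp b)"
  have "n - k \<notin> supp b" if "k \<in> supp a" for k
  proof
    assume "n - k \<in> supp b"
    with that have "k + (n - k) \<in> sumset (supp a) (supp b)" by (intro rev_image_eqI[of "(k, n - k)"]) auto
    with n show False by simp
  qed
  then show "(a \<otimes>\<^bsub>P\<^esub> b) n x = 0"
    by (simp add: mult_eq[OF finite_supp[OF assms] subset_refl] supp_outside)
qed

lemma mult_closed:
  assumes "a \<in> carrier P" "b \<in> carrier P"
  shows "a \<otimes>\<^bsub>P\<^esub> b \<in> carrier P"
proof (rule carrierI[OF _ supp_mult[OF assms(1)]])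
  show "finite (sumset (supp a) (supp b))" using assms by (simp add: finite_supp)
  have "(a \<otimes>\<^bsub>P\<^esub> b) n = (\<lambda>x. \<Sum>k\<in>supp a. a k x * b (n - k) (T (- k) x))" for n
    by (rule ext) (rule mult_eq[OF finite_supp[OF assms(1)] subset_refl])
  moreover have "continuous_on UNIV (\<lambda>x. b m (T k x))" for m k
    by (rule continuous_on_compose2[OF continuous[OF assms(2)] continuous_on_int_iterate[OF homeo]]) simp
  ultimately show "continuous_on UNIV ((a \<otimes>\<^bsub>P\<^esub> b) n)" for n
    by (simp add: continuous_on_sum continuous_on_mult continuous[OF assms(1)])
qed

text \<open>Associativity of twisted convolution: exchange the two sums, substitute
  \<open>k = i + j\<close>, and use that \<open>T\<close> is an action of the integers.\<close>

lemma mult_assoc: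
  assumes "a \<in> carrier P" "b \<in> carrier P" "c \<in> carrier P"
  shows "a \<otimes>\<^bsub>P\<^esub> b \<otimes>\<^bsub>P\<^esub> c = a \<otimes>\<^bsub>P\<^esub> (b \<otimes>\<^bsub>P\<^esub> c)"
proof (intro ext)
  fix n x
  let ?A = "supp a" and ?B = "supp b"
  let ?S = "sumset ?A ?B"
  have S: "finite ?S" using assms by (simp add: finite_supp)
  note a_mult = mult_eq[OF finite_supp[OF assms(1)] subset_refl]
  note b_mult = mult_eq[OF finite_supp[OF assms(2)] subset_refl]
  have inner: "(\<Sum>k\<in>?S. b (k - j) (T (- j) x) * c (n - k) (T (- k) x)) = (b \<otimes>\<^bsub>P\<^esub> c) (n - j) (T (- j) x)"
    if j: "j \<in> ?A" for j
  proof -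
    have "(\<Sum>k\<in>?S. b (k - j) (T (- j) x) * c (n - k) (T (- k) x))
        = (\<Sum>k\<in>(\<lambda>i. i + j) ` ?B. b (k - j) (T (- j) x) * c (n - k) (T (- k) x))"
    proof (rule sum.mono_neutral_right[OF S])
      show "(\<lambda>i. i + j) ` ?B \<subseteq> ?S"
      proof (rule image_subsetI)
        show "i + j \<in> ?S" if "i \<in> ?B" for i using that j by (intro rev_image_eqI[of "(j, i)"]) auto
      qed
      show "\<forall>k\<in>?S - (\<lambda>i. i + j) ` ?B. b (k - j) (T (- j) x) * c (n - k) (T (- k) x) = 0"
      proof
        fix k assume "k \<in> ?S - (\<lambda>i. i + j) ` ?B"
        then have "k - j \<notin> ?B" by (metis DiffD2 diff_add_cancel imageI)
        then show "b (k - j) (T (- j) x) * c (n - k) (T (- k) x) = 0" by (simp add: supp_outside)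
      qed
    qed
    also have "\<dots> = (\<Sum>i\<in>?B. b i (T (- j) x) * c (n - (i + j)) (T (- (i + j)) x))"
      by (subst sum.reindex) (auto simp: inj_on_def)
    also have "\<dots> = (\<Sum>i\<in>?B. b i (T (- j) x) * c (n - j - i) (T (- i) (T (- j) x)))"
    proof (intro sum.cong refl)
      fix i
      have "n - (i + j) = n - j - i" "T (- (i + j)) x = T (- i) (T (- j) x)"
        using int_iterate_add[OF bij, of "- i" "- j" x] by simp_all
      then show "b i (T (- j) x) * c (n - (i + j)) (T (- (i + j)) x)
          = b i (T (- j) x) * c (n - j - i) (T (- i) (T (- j) x))" by (simp only:)
    qed
    finally show ?thesis unfolding b_mult .
  qed
  have "(a \<otimes>\<^bsub>P\<^esub> b \<otimes>\<^bsub>P\<^esub> c) n x = (\<Sum>k\<in>?S. (a \<otimes>\<^bsub>P\<^esub> b) k x * c (n - k) (T (- k) x))"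
    by (rule mult_eq[OF S supp_mult[OF assms(1)]])
  also have "\<dots> = (\<Sum>k\<in>?S. \<Sum>j\<in>?A. a j x * (b (k - j) (T (- j) x) * c (n - k) (T (- k) x)))"
    by (simp only: a_mult sum_distrib_right mult.assoc)
  also have "\<dots> = (\<Sum>j\<in>?A. a j x * (\<Sum>k\<in>?S. b (k - j) (T (- j) x) * c (n - k) (T (- k) x)))"
    by (subst sum.swap) (simp only: sum_distrib_left)
  also have "\<dots> = (a \<otimes>\<^bsub>P\<^esub> (b \<otimes>\<^bsub>P\<^esub> c)) n x"
    unfolding a_mult by (intro sum.cong refl) (simp only: inner)
  finally show "(a \<otimes>\<^bsub>P\<^esub> b \<otimes>\<^bsub>P\<^esub> c) n x = (a \<otimes>\<^bsub>P\<^esub> (b \<otimes>\<^bsub>P\<^esub> c)) n x" .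
qed

definition diag :: "('a \<Rightarrow> complex) \<Rightarrow> int \<Rightarrow> 'a \<Rightarrow> complex" where
  "diag f = (\<lambda>n x. if n = 0 then f x else 0)"

lemma supp_diag: "supp (diag f) \<subseteq> {0}"
  by (rule supp_subsetI) (simp add: diag_def)

lemma diag_closed: "continuous_on UNIV f \<Longrightarrow> diag f \<in> carrier P"
proof (rule carrierI[OF _ supp_diag])
  show "continuous_on UNIV (diag f n)" if "continuous_on UNIV f" for n
    using that by (cases "n = 0") (simp_all add: diag_def)
qed simp

text \<open>This is the covariance relation: moving \<open>f\<close> to the left past
  \<open>u^n\<close> composes it with \<open>\<sigma>^-n\<close>.\<close>

lemma mult_diag:
  assumes "a \<in> carrier P"
  shows "(a \<otimes>\<^bsub>P\<^esub> diag f) n x = a n x * f (T (- n) x)"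
proof -
  \<comment> \<open>Adding \<open>n\<close> to the index set makes the sum pick out a term even when
    \<open>n\<close> is outside the support.\<close>
  have fin: "finite (insert n (supp a))" using assms by (simp add: finite_supp)
  have "(a \<otimes>\<^bsub>P\<^esub> diag f) n x = (\<Sum>k\<in>insert n (supp a). a k x * diag f (n - k) (T (- k) x))"
    by (rule mult_eq[OF fin]) auto
  also have "\<dots> = (\<Sum>k\<in>insert n (supp a). if k = n then a n x * f (T (- n) x) else 0)"
    by (intro sum.cong) (auto simp: diag_def)
  also have "\<dots> = a n x * f (T (- n) x)" by (subst sum.delta[OF fin]) simp
  finally show ?thesis .
qed

lemma diag_mult: "(diag f \<otimes>\<^bsub>P\<^esub> a) n x = f x * a n x"
  by (subst mult_eq[OF _ supp_diag]) (simp_all add: diag_def int_iterate_0)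

lemma one_eq_diag: "\<one>\<^bsub>P\<^esub> = diag (\<lambda>_. 1)"
  by (simp add: P_simps diag_def)

lemma add_closed:
  assumes "a \<in> carrier P" "b \<in> carrier P"
  shows "a \<oplus>\<^bsub>P\<^esub> b \<in> carrier P"
proof (rule carrierI)
  show "finite (supp a \<union> supp b)" using assms by (simp add: finite_supp)
  show "supp (a \<oplus>\<^bsub>P\<^esub> b) \<subseteq> supp a \<union> supp b" by (rule supp_subsetI) (simp add: P_simps supp_outside)
  show "continuous_on UNIV ((a \<oplus>\<^bsub>P\<^esub> b) n)" for n
    unfolding P_simps by (intro continuous_on_add continuous assms)
qed

lemma smult_closed:
  assumes "a \<in> carrier P"
  shows "c \<odot>\<^bsub>P\<^esub> a \<in> carrier P"
proof (rule carrierI)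
  show "finite (supp a)" using assms by (simp add: finite_supp)
  show "supp (c \<odot>\<^bsub>P\<^esub> a) \<subseteq> supp a" by (rule supp_subsetI) (simp add: P_simps supp_outside)
  show "continuous_on UNIV ((c \<odot>\<^bsub>P\<^esub> a) n)" for n
    unfolding P_simps by (intro continuous_on_mult_left continuous assms)
qed

lemma add_mult:
  assumes "a \<in> carrier P" "b \<in> carrier P"
  shows "(a \<oplus>\<^bsub>P\<^esub> b) \<otimes>\<^bsub>P\<^esub> c = a \<otimes>\<^bsub>P\<^esub> c \<oplus>\<^bsub>P\<^esub> b \<otimes>\<^bsub>P\<^esub> c"
proof (intro ext)
  fix n x
  let ?S = "supp a \<union> supp b"
  have S: "finite ?S" using assms by (simp add: finite_supp)
  have "supp (a \<oplus>\<^bsub>P\<^esub> b) \<subseteq> ?S" by (rule supp_subsetI) (simp add: P_simps supp_outside)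
  from mult_eq[OF S this, of c n x] mult_eq[OF S Un_upper1, of c n x] mult_eq[OF S Un_upper2, of c n x]
  show "((a \<oplus>\<^bsub>P\<^esub> b) \<otimes>\<^bsub>P\<^esub> c) n x = (a \<otimes>\<^bsub>P\<^esub> c \<oplus>\<^bsub>P\<^esub> b \<otimes>\<^bsub>P\<^esub> c) n x"
    by (simp add: P_simps distrib_right sum.distrib)
qed

lemma mult_add:
  assumes "a \<in> carrier P"
  shows "a \<otimes>\<^bsub>P\<^esub> (b \<oplus>\<^bsub>P\<^esub> c) = a \<otimes>\<^bsub>P\<^esub> b \<oplus>\<^bsub>P\<^esub> a \<otimes>\<^bsub>P\<^esub> c"
  by (intro ext)
    (simp add: P_simps mult_eq[OF finite_supp[OF assms] subset_refl] distrib_left sum.distrib)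

lemma zero_closed: "\<zero>\<^bsub>P\<^esub> \<in> carrier P"
  by (rule carrierI[of "{}"]) (auto simp: P_simps supp_def)

lemma one_closed: "\<one>\<^bsub>P\<^esub> \<in> carrier P"
  unfolding one_eq_diag by (intro diag_closed continuous_on_const)

abbreviation PU where "PU \<equiv> P\<lparr>nrm := universal_norm P\<rparr>"

lemma PU_simps:
  "carrier PU = carrier P" "a \<otimes>\<^bsub>PU\<^esub> b = a \<otimes>\<^bsub>P\<^esub> b" "a \<oplus>\<^bsub>PU\<^esub> b = a \<oplus>\<^bsub>P\<^esub> b"
  "\<one>\<^bsub>PU\<^esub> = \<one>\<^bsub>P\<^esub>" "\<zero>\<^bsub>PU\<^esub> = \<zero>\<^bsub>P\<^esub>" "nrm PU = universal_norm P"
  by simp_all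

lemma ring_PU: "ring PU"
proof (intro ringI abelian_groupI monoidI, unfold PU_simps)
  fix a b c assume abc: "a \<in> carrier P" "b \<in> carrier P" "c \<in> carrier P"
  show "a \<oplus>\<^bsub>P\<^esub> b \<oplus>\<^bsub>P\<^esub> c = a \<oplus>\<^bsub>P\<^esub> (b \<oplus>\<^bsub>P\<^esub> c)" by (simp add: P_simps add.assoc)
  show "a \<otimes>\<^bsub>P\<^esub> b \<otimes>\<^bsub>P\<^esub> c = a \<otimes>\<^bsub>P\<^esub> (b \<otimes>\<^bsub>P\<^esub> c)" by (rule mult_assoc[OF abc])
  show "(a \<oplus>\<^bsub>P\<^esub> b) \<otimes>\<^bsub>P\<^esub> c = a \<otimes>\<^bsub>P\<^esub> c \<oplus>\<^bsub>P\<^esub> b \<otimes>\<^bsub>P\<^esub> c" by (rule add_mult[OF abc(1,2)])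
  show "c \<otimes>\<^bsub>P\<^esub> (a \<oplus>\<^bsub>P\<^esub> b) = c \<otimes>\<^bsub>P\<^esub> a \<oplus>\<^bsub>P\<^esub> c \<otimes>\<^bsub>P\<^esub> b" by (rule mult_add[OF abc(3)])
next
  fix a b assume ab: "a \<in> carrier P" "b \<in> carrier P"
  show "a \<oplus>\<^bsub>P\<^esub> b \<in> carrier P" by (rule add_closed[OF ab])
  show "a \<otimes>\<^bsub>P\<^esub> b \<in> carrier P" by (rule mult_closed[OF ab])
  show "a \<oplus>\<^bsub>P\<^esub> b = b \<oplus>\<^bsub>P\<^esub> a" by (simp add: P_simps add.commute)
next
  fix a assume a: "a \<in> carrier P"
  show "\<zero>\<^bsub>P\<^esub> \<oplus>\<^bsub>P\<^esub> a = a" by (simp add: P_simps)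
  show "\<exists>b\<in>carrier P. b \<oplus>\<^bsub>P\<^esub> a = \<zero>\<^bsub>P\<^esub>"
    using smult_closed[OF a, of "-1"] by (rule bexI[rotated]) (simp add: P_simps)
  show "\<one>\<^bsub>P\<^esub> \<otimes>\<^bsub>P\<^esub> a = a" "a \<otimes>\<^bsub>P\<^esub> \<one>\<^bsub>P\<^esub> = a"
    by (simp_all add: one_eq_diag diag_mult mult_diag[OF a] fun_eq_iff)
qed (rule zero_closed one_closed)+

text \<open>Writes negation as a scalar multiple, so that homogeneity of the seminorms
  applies.\<close>

lemma PU_uminus: "a \<in> carrier P \<Longrightarrow> \<ominus>\<^bsub>PU\<^esub> a = (-1) \<odot>\<^bsub>P\<^esub> a"
proof -
  interpret ring PU by (rule ring_PU)
  assume a: "a \<in> carrier P"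
  then show ?thesis using smult_closed[OF a, of "-1"]
    by (intro minus_equality) (simp_all only: PU_simps, simp add: P_simps)
qed

section \<open>The l^1 norm and the universal norm\<close>

lemma nrm_P: "nrm P a = (\<Sum>n | a n \<noteq> (\<lambda>x. 0). SUP x. cmod (a n x))"
  by (simp add: finsupp_crossed_product_def)

lemma nrm_P_nonneg:
  assumes "a \<in> carrier P"
  shows "0 \<le> nrm P a"
  unfolding nrm_P
proof (intro sum_nonneg)
  fix n
  have "continuous_on UNIV (\<lambda>x. cmod (a n x))"
    using assms by (intro continuous_on_norm) (simp add: carrier_iff)
  then have "compact (range (\<lambda>x. cmod (a n x)))" using compact_UNIV by (rule compact_continuous_image)
  then have "bdd_above (range (\<lambda>x. cmod (a n x)))" by (intro bounded_imp_bdd_above compact_imp_bounded)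
  \<comment> \<open>\<open>undefined\<close> serves as an arbitrary point of the space; the supremum
    is genuine by compactness.\<close>
  then show "0 \<le> (SUP x. cmod (a n x))"
    using cSUP_upper2[of "\<lambda>x. cmod (a n x)" UNIV undefined 0] by simp
qed

lemma nrm_P_diag_le:
  assumes "\<And>x. cmod (f x) \<le> r"
  shows "nrm P (diag f) \<le> r"
proof -
  \<comment> \<open>For \<open>f = 0\<close> the sum defining the norm is empty, so \<open>r\<close>
    must be known to be nonnegative.\<close>
  have r: "0 \<le> r" using assms[of undefined] norm_ge_zero order_trans by blast
  have "{n. diag f n \<noteq> (\<lambda>x. 0)} = (if f = (\<lambda>x. 0) then {} else {0})"
    by (auto simp: diag_def)
  moreover have "(SUP x. cmod (diag f 0 x)) \<le> r"
    by (intro cSUP_least) (auto simp: diag_def assms)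
  ultimately show ?thesis using r by (simp add: nrm_P)
qed

definition seminorms where
  "seminorms = {p. cstar_seminorm P p \<and> (\<forall>b\<in>carrier P. p b \<le> nrm P b)}"

lemma seminormsD:
  assumes "p \<in> seminorms" "a \<in> carrier P"
  shows "0 \<le> p a" "p a \<le> nrm P a" "p (c \<odot>\<^bsub>P\<^esub> a) = cmod c * p a"
    and "b \<in> carrier P \<Longrightarrow> p (a \<oplus>\<^bsub>P\<^esub> b) \<le> p a + p b"
    and "b \<in> carrier P \<Longrightarrow> p (a \<otimes>\<^bsub>P\<^esub> b) \<le> p a * p b"
  using assms unfolding seminorms_def cstar_seminorm_def by blast+

lemma universal_norm_eq: "universal_norm P a = (SUP p\<in>seminorms. p a)"
  by (simp add: universal_norm_def seminorms_def)

text \<open>Makes the family nonempty, so that its supremum is at most any common upper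
  bound.\<close>

lemma zero_seminorm: "(\<lambda>_. 0) \<in> seminorms"
  by (auto simp: seminorms_def cstar_seminorm_def nrm_P_nonneg)

lemma le_universal_norm: "p \<in> seminorms \<Longrightarrow> a \<in> carrier P \<Longrightarrow> p a \<le> universal_norm P a"
  unfolding universal_norm_eq by (intro cSUP_upper bdd_aboveI2[where M = "nrm P a"] seminormsD) auto

lemma universal_norm_leI: "(\<And>p. p \<in> seminorms \<Longrightarrow> p a \<le> r) \<Longrightarrow> universal_norm P a \<le> r"
  unfolding universal_norm_eq using zero_seminorm by (intro cSUP_least) auto

lemma universal_norm_le_nrm: "a \<in> carrier P \<Longrightarrow> universal_norm P a \<le> nrm P a"
  by (rule universal_norm_leI) (rule seminormsD)

lemma universal_norm_smult_one:
  assumes "a \<in> carrier P" "cmod c = 1"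
  shows "universal_norm P (c \<odot>\<^bsub>P\<^esub> a) = universal_norm P a"
  unfolding universal_norm_eq by (intro SUP_cong refl) (simp add: seminormsD(3)[OF _ assms(1)] assms(2))

text \<open>The defining inequalities pass to suprema: bound each seminorm of the family on the
  right by the universal norm, then take the supremum on the left.\<close>

lemma seminormed_ring_PU: "seminormed_ring PU"
proof (intro seminormed_ring.intro seminormed_ring_axioms.intro ring_PU, unfold PU_simps)
  fix a b assume ab: "a \<in> carrier P" "b \<in> carrier P"
  note le = le_universal_norm[OF _ ab(1)] le_universal_norm[OF _ ab(2)]
  show "universal_norm P (a \<oplus>\<^bsub>P\<^esub> b) \<le> universal_norm P a + universal_norm P b"
  proof (rule universal_norm_leI)
    fix p assume p: "p \<in> seminorms"
    show "p (a \<oplus>\<^bsub>P\<^esub> b) \<le> universal_norm P a + universal_norm P b"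
      using seminormsD(4)[OF p ab] le[OF p] by linarith
  qed
  show "universal_norm P (a \<otimes>\<^bsub>P\<^esub> b) \<le> universal_norm P a * universal_norm P b"
  proof (rule universal_norm_leI)
    fix p assume p: "p \<in> seminorms"
    have "p (a \<otimes>\<^bsub>P\<^esub> b) \<le> p a * p b" by (rule seminormsD(5)[OF p ab])
    also have "\<dots> \<le> universal_norm P a * universal_norm P b"
      using seminormsD(1)[OF p ab(1)] seminormsD(1)[OF p ab(2)] le[OF p] by (intro mult_mono) auto
    finally show "p (a \<otimes>\<^bsub>P\<^esub> b) \<le> universal_norm P a * universal_norm P b" .
  qed
next
  fix a assume a: "a \<in> carrier P"
  show "0 \<le> universal_norm P a" using le_universal_norm[OF zero_seminorm a] .
  show "universal_norm P (\<ominus>\<^bsub>PU\<^esub> a) = universal_norm P a"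
    unfolding PU_uminus[OF a] by (rule universal_norm_smult_one[OF a]) simp
next
  have "nrm P \<zero>\<^bsub>P\<^esub> = 0" by (simp add: nrm_P P_simps)
  then show "universal_norm P \<zero>\<^bsub>P\<^esub> = 0"
    using universal_norm_le_nrm[OF zero_closed] le_universal_norm[OF zero_seminorm zero_closed] by simp
qed

section \<open>Cuntz subequivalence in the crossed product\<close>

lemma crossed_product_eq: "crossed_product \<sigma> = completion PU"
  by (simp add: crossed_product_def enveloping_cstar_algebra_def)

lemma crossed_embedding_eq: "crossed_embedding \<sigma> f = seq_class PU (\<lambda>_. diag f)"
  by (simp add: crossed_embedding_def enveloping_embedding_def diag_def)

text \<open>Witnesses can be taken among constant sequences. The error is then the class of a
  \<open>diag\<close> element, whose universal norm is at most its l^1 norm and so at most the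
  uniform bound \<open>\<epsilon>\<close>, taken as \<open>1 / Suc n\<close>.\<close>

lemma cuntz_subeqI:
  assumes f: "continuous_on UNIV f" and g: "continuous_on UNIV g"
    and approx: "\<And>\<epsilon>. 0 < \<epsilon> \<Longrightarrow> \<exists>a\<in>carrier P. \<exists>b\<in>carrier P. \<exists>r.
      (\<forall>x. cmod (r x - f x) \<le> \<epsilon>) \<and> a \<otimes>\<^bsub>P\<^esub> diag g \<otimes>\<^bsub>P\<^esub> b = diag r"
  shows "cuntz_subeq (crossed_product \<sigma>) (crossed_embedding \<sigma> f) (crossed_embedding \<sigma> g)"
proof -
  interpret seminormed_ring PU by (rule seminormed_ring_PU)
  note fg = diag_closed[OF f] diag_closed[OF g]
  have "\<exists>a b r. a \<in> carrier P \<and> b \<in> carrier P \<and>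
      (\<forall>x. cmod (r x - f x) \<le> 1 / Suc n) \<and> a \<otimes>\<^bsub>P\<^esub> diag g \<otimes>\<^bsub>P\<^esub> b = diag r" for n
    using approx[of "1 / Suc n"] by (simp add: Bex_def)
  then obtain a b r where ab: "\<And>n. a n \<in> carrier P" "\<And>n. b n \<in> carrier P"
    and r: "\<And>n x. cmod (r n x - f x) \<le> 1 / Suc n" "\<And>n. a n \<otimes>\<^bsub>P\<^esub> diag g \<otimes>\<^bsub>P\<^esub> b n = diag (r n)"
    by metis
  define A where "A n = seq_class PU (\<lambda>_. a n)" for n
  define B where "B n = seq_class PU (\<lambda>_. b n)" for n
  let ?C = "completion PU"
  let ?d = "\<lambda>n. nrm ?C (A n \<otimes>\<^bsub>?C\<^esub> seq_class PU (\<lambda>_. diag g) \<otimes>\<^bsub>?C\<^esub> B n \<ominus>\<^bsub>?C\<^esub> seq_class PU (\<lambda>_. diag f))"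
  have d: "0 \<le> ?d n \<and> ?d n \<le> 1 / Suc n" for n
  proof -
    have c: "a n \<in> carrier PU" "b n \<in> carrier PU" "diag f \<in> carrier PU" "diag g \<in> carrier PU"
      using ab fg by simp_all
    have c': "a n \<otimes>\<^bsub>PU\<^esub> diag g \<in> carrier PU" "a n \<otimes>\<^bsub>PU\<^esub> diag g \<otimes>\<^bsub>PU\<^esub> b n \<in> carrier PU"
      by (intro m_closed c)+
    let ?e = "a n \<otimes>\<^bsub>PU\<^esub> diag g \<otimes>\<^bsub>PU\<^esub> b n \<ominus>\<^bsub>PU\<^esub> diag f"
    have e: "?e \<in> carrier PU" by (intro minus_closed c c')
    have "A n \<otimes>\<^bsub>?C\<^esub> seq_class PU (\<lambda>_. diag g) \<otimes>\<^bsub>?C\<^esub> B n \<ominus>\<^bsub>?C\<^esub> seq_class PU (\<lambda>_. diag f)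
        = seq_class PU (\<lambda>_. ?e)"
      unfolding A_def B_def
      by (simp only: seq_class_const_hom(1)[OF c(1,4)] seq_class_const_hom(1)[OF c'(1) c(2)]
          seq_class_const_hom(2)[OF c'(2) c(3)])
    then have eq: "?d n = universal_norm P ?e"
      using nrm_seq_class_const[OF e] unfolding PU_simps by simp
    have "?e = diag (\<lambda>x. r n x - f x)"
      unfolding minus_eq PU_uminus[OF fg(1)] PU_simps r(2) by (simp add: P_simps diag_def fun_eq_iff)
    then have "nrm P ?e \<le> 1 / Suc n" using nrm_P_diag_le[of "\<lambda>x. r n x - f x"] r(1) by simp
    then show ?thesis
      unfolding eq using universal_norm_le_nrm[of ?e] nrm_nonneg[OF e] e unfolding PU_simps by linarith
  qed
  have "?d \<longlonglongrightarrow> 0"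
  proof (rule tendsto_sandwich[OF _ _ tendsto_const])
    show "(\<lambda>n. 1 / real (Suc n)) \<longlonglongrightarrow> 0"
      using LIMSEQ_inverse_real_of_nat by (simp add: inverse_eq_divide)
  qed (use d in auto)
  moreover have "A n \<in> carrier ?C" "B n \<in> carrier ?C" for n
    unfolding A_def B_def using ab seq_class_const_hom(3)[of "a n" "a n"] seq_class_const_hom(3)[of "b n" "b n"]
    by simp_all
  ultimately show ?thesis
    unfolding cuntz_subeq_def crossed_product_eq crossed_embedding_eq
    by (intro exI[of _ A] exI[of _ B] conjI allI)
qed

lemma cuntz_subeq_of_dynamical_comparison:
  fixes \<phi> \<psi> :: "'a \<Rightarrow> real"
  assumes \<phi>: "continuous_on UNIV \<phi>" and \<psi>: "continuous_on UNIV \<psi>"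
    and cmp: "\<And>\<epsilon>. 0 < \<epsilon> \<Longrightarrow> \<exists>(M :: nat) v w. (\<forall>k. continuous_on UNIV (v k) \<and> continuous_on UNIV (w k)) \<and>
      (\<forall>k l x y. v k x \<noteq> 0 \<longrightarrow> w l y \<noteq> 0 \<longrightarrow> (\<sigma> ^^ k) x = (\<sigma> ^^ l) y \<longrightarrow> k = l) \<and>
      (\<forall>x. \<bar>(\<Sum>k<M. v k x * \<psi> ((\<sigma> ^^ k) x) * w k x) - \<phi> x\<bar> \<le> \<epsilon>)"
  shows "cuntz_subeq (crossed_product \<sigma>) (crossed_embedding \<sigma> (\<lambda>x. complex_of_real (\<phi> x)))
    (crossed_embedding \<sigma> (\<lambda>x. complex_of_real (\<psi> x)))"
proof (rule cuntz_subeqI)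
  show "continuous_on UNIV (\<lambda>x. complex_of_real (\<phi> x))" "continuous_on UNIV (\<lambda>x. complex_of_real (\<psi> x))"
    using \<phi> \<psi> by (simp_all add: continuous_on_of_real)
  fix \<epsilon> :: real assume "0 < \<epsilon>"
  from cmp[OF this] obtain M :: nat and v w
    where cont: "\<forall>k. continuous_on UNIV (v k) \<and> continuous_on UNIV (w k)"
    and disj: "\<forall>k l x y. v k x \<noteq> 0 \<longrightarrow> w l y \<noteq> 0 \<longrightarrow> (\<sigma> ^^ k) x = (\<sigma> ^^ l) y \<longrightarrow> k = l"
    and approx: "\<forall>x. \<bar>(\<Sum>k<M. v k x * \<psi> ((\<sigma> ^^ k) x) * w k x) - \<phi> x\<bar> \<le> \<epsilon>"
    by (elim exE conjE)
  have cont: "continuous_on UNIV (v k)" "continuous_on UNIV (w k)" for k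
    using cont by simp_all
  \<comment> \<open>The finite sum of the \<open>v k * u^-k\<close>.\<close>
  define a where "a n x = (if n \<in> (\<lambda>k. - int k) ` {..<M} then complex_of_real (v (nat (- n)) x) else 0)" for n x
  \<comment> \<open>The finite sum of the \<open>u^l * w l\<close>; moving \<open>w l\<close> to the
    left of \<open>u^l\<close> produces the shift by \<open>T (- n)\<close>.\<close>
  define b where "b n x = (if n \<in> int ` {..<M} then complex_of_real (w (nat n) (T (- n) x)) else 0)" for n x
  define r where "r x = complex_of_real (\<Sum>k<M. v k x * \<psi> ((\<sigma> ^^ k) x) * w k x)" for x
  have supp_a: "supp a \<subseteq> (\<lambda>k. - int k) ` {..<M}" by (rule supp_subsetI) (simp add: a_def)
  have supp_b: "supp b \<subseteq> int ` {..<M}" by (rule supp_subsetI) (simp add: b_def)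
  have "continuous_on UNIV (a n)" for n
    by (cases "n \<in> (\<lambda>k. - int k) ` {..<M}") (simp_all add: a_def[abs_def] continuous_on_of_real cont)
  then have a: "a \<in> carrier P" by (intro carrierI[OF _ supp_a]) simp_all
  have "continuous_on UNIV (\<lambda>x. w k (T n x))" for k :: nat and n
    by (rule continuous_on_compose2[OF cont(2) continuous_on_int_iterate[OF homeo]]) simp
  then have "continuous_on UNIV (b n)" for n
    by (cases "n \<in> int ` {..<M}") (simp_all add: b_def[abs_def] continuous_on_of_real)
  then have b: "b \<in> carrier P" by (intro carrierI[OF _ supp_b]) simp_all
  have supp_a\<psi>: "supp (a \<otimes>\<^bsub>P\<^esub> diag (\<lambda>x. complex_of_real (\<psi> x))) \<subseteq> (\<lambda>k. - int k) ` {..<M}"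
    by (rule supp_subsetI) (simp add: mult_diag[OF a] a_def)
  have "a \<otimes>\<^bsub>P\<^esub> diag (\<lambda>x. complex_of_real (\<psi> x)) \<otimes>\<^bsub>P\<^esub> b = diag r"
  proof (intro ext)
    fix n :: int and x
    have "(a \<otimes>\<^bsub>P\<^esub> diag (\<lambda>x. complex_of_real (\<psi> x)) \<otimes>\<^bsub>P\<^esub> b) n x
        = (\<Sum>k\<in>(\<lambda>k. - int k) ` {..<M}. a k x * \<psi> (T (- k) x) * b (n - k) (T (- k) x))"
      by (subst mult_eq[OF _ supp_a\<psi>]) (simp_all add: mult_diag[OF a])
    also have "\<dots> = (\<Sum>k<M. v k x * \<psi> ((\<sigma> ^^ k) x) * b (n + int k) ((\<sigma> ^^ k) x))"
      by (subst sum.reindex) (auto simp: inj_on_def a_def int_iterate_of_nat intro!: sum.cong)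
    also have "\<dots> = (\<Sum>k<M. if n = 0 then v k x * \<psi> ((\<sigma> ^^ k) x) * complex_of_real (w k x) else 0)"
    proof (intro sum.cong refl)
      fix k assume k: "k \<in> {..<M}"
      have unshift: "T (- int k) ((\<sigma> ^^ k) x) = x"
        using int_iterate_uminus(1)[OF bij, of "int k" x] by (simp add: int_iterate_of_nat)
      show "v k x * \<psi> ((\<sigma> ^^ k) x) * b (n + int k) ((\<sigma> ^^ k) x)
          = (if n = 0 then v k x * \<psi> ((\<sigma> ^^ k) x) * complex_of_real (w k x) else 0)"
      proof (cases "n = 0")
        case True
        then show ?thesis using k by (simp add: b_def unshift)
      next
        case n: False
        \<comment> \<open>A nonzero term off the diagonal would have
          \<open>n + int k = int l\<close>, with \<open>w l\<close> nonzero at the point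
          \<open>y\<close> whose \<open>l\<close>-th image is \<open>(\<sigma> ^^ k) x\<close>.
          Disjointness then gives \<open>k = l\<close>, hence \<open>n = 0\<close>.\<close>
        have "v k x = 0 \<or> b (n + int k) ((\<sigma> ^^ k) x) = 0"
        proof (rule ccontr)
          assume nz: "\<not> ?thesis"
          then obtain l where l: "n + int k = int l" by (auto simp: b_def split: if_splits)
          have "w l (T (- int l) ((\<sigma> ^^ k) x)) \<noteq> 0" using nz by (auto simp: b_def l split: if_splits)
          moreover have "(\<sigma> ^^ k) x = (\<sigma> ^^ l) (T (- int l) ((\<sigma> ^^ k) x))"
            using int_iterate_uminus(2)[OF bij, of "int l" "(\<sigma> ^^ k) x"] by (simp add: int_iterate_of_nat)
          ultimately have "k = l" using nz disj by blast
          with l n show False by simp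
        qed
        with n show ?thesis by auto
      qed
    qed
    also have "\<dots> = diag r n x" by (simp add: diag_def r_def)
    finally show "(a \<otimes>\<^bsub>P\<^esub> diag (\<lambda>x. complex_of_real (\<psi> x)) \<otimes>\<^bsub>P\<^esub> b) n x = diag r n x" .
  qed
  moreover have "cmod (r x - complex_of_real (\<phi> x)) \<le> \<epsilon>" for x
    using spec[OF approx, of x] unfolding r_def by (simp only: of_real_diff[symmetric] norm_of_real)
  ultimately show "\<exists>a\<in>carrier P. \<exists>b\<in>carrier P. \<exists>r. (\<forall>x. cmod (r x - complex_of_real (\<phi> x)) \<le> \<epsilon>) \<and>
      a \<otimes>\<^bsub>P\<^esub> diag (\<lambda>x. complex_of_real (\<psi> x)) \<otimes>\<^bsub>P\<^esub> b = diag r"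
    by (intro bexI[OF _ a] bexI[OF _ b] exI[of _ r] conjI allI)
qed

end

theorem corollary7p9:
  fixes \<sigma> :: "'a::metric_space \<Rightarrow> 'a"
    and E F :: "'a set"
    and \<phi>E \<phi>F :: "'a \<Rightarrow> real"
  assumes "compact (UNIV :: 'a set)"
    and "homeomorphic_map euclidean euclidean \<sigma>"
    and "minimal_homeo \<sigma>"
    and "free_homeo \<sigma>"
    and "open E"
    and "open F"
    and "\<And>\<mu>. \<mu> \<in> invariant_prob_measures \<sigma> \<Longrightarrow> measure \<mu> E < 1/4 * measure \<mu> F"
    and "open_support_function E \<phi>E"
    and "open_support_function F \<phi>F"
  shows "cuntz_subeq (crossed_product \<sigma>)
           (crossed_embedding \<sigma> (\<lambda>x. complex_of_real (\<phi>E x)))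
           (crossed_embedding \<sigma> (\<lambda>x. complex_of_real (\<phi>F x)))"
proof -
  interpret compact_homeo \<sigma> using assms(1,2) by (rule compact_homeo.intro)
  \<comment> \<open>The factor 2 matches the intervals of length \<open>2 * e x\<close> laid out
    along the orbits.\<close>
  have meas: "2 * measure \<mu> E < measure \<mu> F" if "\<mu> \<in> invariant_prob_measures \<sigma>" for \<mu>
    using assms(7)[OF that] measure_nonneg[of \<mu> E] by linarith
  show ?thesis
  proof (rule cuntz_subeq_of_dynamical_comparison)
    show "continuous_on UNIV \<phi>E" "continuous_on UNIV \<phi>F"
      using assms(8,9) by (simp_all add: open_support_function_def)
    fix \<epsilon> :: real assume "0 < \<epsilon>"
    show "\<exists>(M :: nat) v w. (\<forall>k. continuous_on UNIV (v k) \<and> continuous_on UNIV (w k)) \<and>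
      (\<forall>k l x y. v k x \<noteq> 0 \<longrightarrow> w l y \<noteq> 0 \<longrightarrow> (\<sigma> ^^ k) x = (\<sigma> ^^ l) y \<longrightarrow> k = l) \<and>
      (\<forall>x. \<bar>(\<Sum>k<M. v k x * \<phi>F ((\<sigma> ^^ k) x) * w k x) - \<phi>E x\<bar> \<le> \<epsilon>)"
      by (rule dynamical_comparison[OF assms(1,2,5,6) meas assms(8,9) \<open>0 < \<epsilon>\<close>])
  qed
qed

end
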